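(* Let $s\in[2,+\infty)$, $\alpha>0$, $d\ge1$ be an integer and $\epsilon>0$. There is a positive number $C$ depending only on $s,d,\alpha$ and $\epsilon$ such that the following holds for all $r>0$ and $n\ge1$. Let $\mathcal F^d_{\alpha,s,\infty}(r)$ be the class of all probability densities $p$ on $\mathbb R^d$ that belong to $B^\alpha_{s,\infty}(\mathbb R^d)\cap\mathscr L_2(\mathbb R^d)$ and whose Besov semi-norm $|p|_{\alpha,s,\infty}$ is at most $r$. There exists an $\ell_2$-estimator $\widehat p$ (depending on $s,\alpha$ and $r$), based on $n$ i.i.d. observations $X_1,\ldots,X_n$ with density $p^\star$ with respect to the Lebesgue measure $\lambda$ on $\mathbb R^d$, that satisfies, whatever $p^\star$, $$\mathbb E\left[\|p^\star-\widehat p\|_{\lambda,2}^2\right]\le C\left[\inf_{p\in\mathcal F^d_{\alpha,s,\infty}(r)}\|p^\star-p\|_{\lambda,2}^2+\frac{r^{ds/[d(s-1)+s\alpha]}}{n^{\alpha s/[d(s-1)+s\alpha]}}+\frac1n\right].$$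
   Context: $\mathscr L_j(\mathbb R^d)$ is the set of measurable functions on $\mathbb R^d$ with $\|f\|_{\lambda,j}=(\int|f|^jd\lambda)^{1/j}<\infty$; $\|f\|_\infty=\sup_x|f(x)|$. Besov space: with $m=\lfloor\alpha\rfloor+1$ and $\Delta_h^m$ the $m$-th order finite difference operator with step $h\in\mathbb R^d$, $B^\alpha_{s,\infty}(\mathbb R^d)$ is the set of $f\in\mathscr L_s(\mathbb R^d)$ with $|f|_{\alpha,s,\infty}=\sup_{h\ne0}|h|^{-\alpha}\|\Delta_h^mf\|_{\lambda,s}<\infty$, and $|f|_{\alpha,s,\infty}$ is its Besov semi-norm. (Semi-norms equivalent up to constants depending on $\alpha,s,d$ only affect the constant $C$.) $\ell_2$-estimator: let $\mathcal M$ be an at most countable nonempty subset of $\mathscr L_1(\mathbb R^d)\cap\mathscr L_2(\mathbb R^d)$ (whose elements need not be probability densities) and $R>0$ with $\|p-q\|_\infty\le R\|p-q\|_{\lambda,2}$ for all $p,q\in\mathcal M$. For $p,q\in\mathcal M$ let $f_{(p,q)}=(p-q)/\|p-q\|_{\lambda,2}$ if $p\ne q$, $f_{(p,p)}=0$, and $$t_{(p,q)}=\frac1{2R}\left[\int f_{(p,q)}\frac{p+q}{2}\,d\lambda-f_{(p,q)}\right],\qquad \mathbf T(\boldsymbol X,p)=\sup_{q\in\mathcal M}\sum_{i=1}^nt_{(p,q)}(X_i).$$ An $\ell_2$-estimator (based on $\mathcal M$, with parameter $\epsilon$) is any measurable random element $\widehat p=\widehat p(X_1,\ldots,X_n)$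 of $\mathcal M$ with $\mathbf T(\boldsymbol X,\widehat p)\le\inf_{p\in\mathcal M}\mathbf T(\boldsymbol X,p)+\epsilon$. *)

theory Defs
  imports "HOL-Analysis.Analysis"
begin

definition ennreal_powr :: "ennreal \<Rightarrow> real \<Rightarrow> ennreal" where
  "ennreal_powr x a = (if x = top then top else ennreal (enn2real x powr a))"
  (* only used with exponents a > 0 *)

definition Lnorm :: "real \<Rightarrow> ('a::euclidean_space \<Rightarrow> real) \<Rightarrow> ennreal" where
  "Lnorm j f = ennreal_powr (\<integral>\<^sup>+x. ennreal (\<bar>f x\<bar> powr j) \<partial>lborel) (1 / j)"

(* Functions, not classes modulo equality almost everywhere. *)
definition Lspace :: "real \<Rightarrow> ('a::euclidean_space \<Rightarrow> real) set" where
  "Lspace j = {f \<in> borel_measurable borel. Lnorm j f < top}"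

(* A true pointwise supremum, not an essential supremum. *)
definition sup_norm :: "('a \<Rightarrow> real) \<Rightarrow> ennreal" where
  "sup_norm f = (SUP x. ennreal \<bar>f x\<bar>)"

definition finite_difference ::
    "nat \<Rightarrow> 'a::euclidean_space \<Rightarrow> ('a \<Rightarrow> real) \<Rightarrow> ('a \<Rightarrow> real)" where
  "finite_difference m h = (\<lambda>f x. f (x + h) - f x) ^^ m"

definition besov_seminorm :: "real \<Rightarrow> real \<Rightarrow> ('a::euclidean_space \<Rightarrow> real) \<Rightarrow> ennreal" where
  "besov_seminorm \<alpha> s f =
     (SUP h\<in>{h. h \<noteq> 0}.
        ennreal (norm h powr (- \<alpha>)) * Lnorm s (finite_difference (nat \<lfloor>\<alpha>\<rfloor> + 1) h f))"

(* The space B^alpha_{s,infinity}. *)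
definition besov_space :: "real \<Rightarrow> real \<Rightarrow> ('a::euclidean_space \<Rightarrow> real) set" where
  "besov_space \<alpha> s = {f \<in> Lspace s. besov_seminorm \<alpha> s f < top}"

definition prob_density :: "('a::euclidean_space \<Rightarrow> real) \<Rightarrow> bool" where
  "prob_density p \<longleftrightarrow>
     p \<in> borel_measurable borel \<and> (\<forall>x. 0 \<le> p x) \<and> (\<integral>\<^sup>+x. ennreal (p x) \<partial>lborel) = 1"

definition besov_densities ::
    "real \<Rightarrow> real \<Rightarrow> real \<Rightarrow> ('a::euclidean_space \<Rightarrow> real) set" where
  "besov_densities \<alpha> s r =
     {p \<in> besov_space \<alpha> s \<inter> Lspace 2. prob_density p \<and> besov_seminorm \<alpha> s p \<le> ennreal r}"

definition l2_model :: "('a::euclidean_space \<Rightarrow> real) set \<Rightarrow> real \<Rightarrow> bool" where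
  "l2_model M R \<longleftrightarrow>
     countable M \<and> M \<noteq> {} \<and> M \<subseteq> Lspace 1 \<inter> Lspace 2 \<and> 0 < R \<and>
     (\<forall>p\<in>M. \<forall>q\<in>M. sup_norm (\<lambda>x. p x - q x) \<le> ennreal R * Lnorm 2 (\<lambda>x. p x - q x))"

definition l2_direction ::
    "('a::euclidean_space \<Rightarrow> real) \<Rightarrow> ('a \<Rightarrow> real) \<Rightarrow> 'a \<Rightarrow> real" where
  "l2_direction p q x =
     (if p = q then 0 else (p x - q x) / enn2real (Lnorm 2 (\<lambda>y. p y - q y)))"

definition l2_test ::
    "real \<Rightarrow> ('a::euclidean_space \<Rightarrow> real) \<Rightarrow> ('a \<Rightarrow> real) \<Rightarrow> 'a \<Rightarrow> real" where
  "l2_test R p q x =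
     1 / (2 * R) *
       ((\<integral>y. l2_direction p q y * ((p y + q y) / 2) \<partial>lborel) - l2_direction p q x)"

(* Extended-real valued, since the supremum over the model may be infinite. *)
definition l2_stat ::
    "('a::euclidean_space \<Rightarrow> real) set \<Rightarrow> real \<Rightarrow> nat \<Rightarrow> (nat \<Rightarrow> 'a) \<Rightarrow> ('a \<Rightarrow> real) \<Rightarrow> ereal" where
  "l2_stat M R n X p = (SUP q\<in>M. ereal (\<Sum>i<n. l2_test R p q (X i)))"

(* A sample X_1, ..., X_n is a function on the index set {..<n}; the countable model carries
   the discrete sigma-algebra. *)
definition l2_estimator ::
    "('a::euclidean_space \<Rightarrow> real) set \<Rightarrow> real \<Rightarrow> real \<Rightarrow> nat \<Rightarrow>
      ((nat \<Rightarrow> 'a) \<Rightarrow> ('a \<Rightarrow> real)) \<Rightarrow> bool" where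
  "l2_estimator M R \<epsilon> n phat \<longleftrightarrow>
     l2_model M R \<and>
     phat \<in> measurable (PiM {..<n} (\<lambda>_. borel)) (count_space M) \<and>
     (\<forall>X \<in> space (PiM {..<n} (\<lambda>_. borel :: 'a measure)).
        l2_stat M R n X (phat X) \<le> (INF p\<in>M. l2_stat M R n X p) + ereal \<epsilon>)"

(* The law of n i.i.d. observations with density p. *)
definition iid_law :: "nat \<Rightarrow> ('a::euclidean_space \<Rightarrow> real) \<Rightarrow> (nat \<Rightarrow> 'a) measure" where
  "iid_law n p = PiM {..<n} (\<lambda>_. density lborel (\<lambda>x. ennreal (p x)))"

end

theory Submission
  imports Defs "HOL-Probability.Infinite_Product_Measure"
begin

text \<open>
  The estimator minimises the test statistic over a countable family of smoothed functions, and
  its risk is a sum of an approximation error and a variance, balanced by the bandwidth \<open>\<delta>\<close>.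

  Approximation. Let m be the order of the differences in the Besov semi-norm and draw u from a
  fixed density on the unit ball. The mean of the differences of f of order m with step \<open>\<delta> u\<close> is,
  up to sign, \<open>f - K f\<close>, where K is an integral operator whose kernel \<open>\<kappa>\<close> satisfies
  \<open>\<bar>\<kappa>\<bar>\<^sub>2\<^sup>2 \<le> G / \<delta>\<^sup>d\<close> (\<open>bounded_kernel_difference_kernel\<close>). The differences of a density are
  bounded in \<open>L\<^sub>1\<close>, and in \<open>L\<^sub>s\<close> by the Besov semi-norm. Since
  \<open>y\<^sup>2 \<le> \<tau> * y + \<tau> powr (2 - s) * y powr s\<close>, these two bounds give an \<open>L\<^sub>2\<close> bound b for
  \<open>f - K f\<close> (\<open>smoothing_error\<close>). If \<open>\<tau>\<close> is the rate of the theorem and \<open>\<delta>\<close> is chosen with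
  \<open>n \<tau> \<delta>\<^sup>d = 1\<close>, then \<open>b\<^sup>2\<close> and \<open>\<bar>\<kappa>\<bar>\<^sub>2\<^sup>2 / n\<close> are both of order \<open>\<tau>\<close> (\<open>optimal_bandwidth\<close>).

  The model. Cauchy-Schwarz gives \<open>sup \<bar>K f\<bar> \<le> \<bar>\<kappa>\<bar>\<^sub>2 \<bar>f\<bar>\<^sub>2\<close>, whereas a model for the estimator needs
  a bound by \<open>\<bar>K f\<bar>\<^sub>2\<close>. The two norms are comparable on differences as soon as f and g are at
  distance at least \<open>3 b\<close>, because then \<open>\<bar>f - g\<bar>\<^sub>2 \<le> \<bar>K f - K g\<bar>\<^sub>2 + 2 b\<close> implies
  \<open>\<bar>f - g\<bar>\<^sub>2 \<le> 3 \<bar>K f - K g\<bar>\<^sub>2\<close>. The model is therefore the image under K of a maximal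
  \<open>3 b\<close>-separated subset of a Besov ball. Maximality costs only a further \<open>3 b\<close> in approximation,
  and separation also makes the model countable (\<open>countable_separated_continuous_L2\<close>).

  Variance. Transposing K turns the supremum of the empirical process over all test directions into
  a norm: it is at most three times the \<open>L\<^sub>2\<close> norm of a kernel density estimator minus its mean
  (\<open>empirical_process_bound\<close>). Its expected square is at most \<open>\<bar>\<kappa>\<bar>\<^sub>2\<^sup>2 / n\<close> by independence
  (\<open>expected_kernel_deviation\<close>), so a second-moment computation takes the place of a
  concentration inequality.

  The two parts are joined by \<open>l2_estimator_oracle_inequality\<close>, which holds for each sample and
  rests on a polarization identity.
\<close>

section \<open>The Hilbert space of square integrable functions\<close>

definition l2norm :: "('a::euclidean_space \<Rightarrow> real) \<Rightarrow> real" where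
  "l2norm f = enn2real (Lnorm 2 f)"

lemma Lnorm_2_square: "(Lnorm 2 f)\<^sup>2 = (\<integral>\<^sup>+x. ennreal ((f x)\<^sup>2) \<partial>lborel)"
proof -
  have eq: "(\<integral>\<^sup>+x. ennreal (\<bar>f x\<bar> powr 2) \<partial>lborel) = (\<integral>\<^sup>+x. ennreal ((f x)\<^sup>2) \<partial>lborel)"
    by simp
  show ?thesis
  proof (cases "(\<integral>\<^sup>+x. ennreal ((f x)\<^sup>2) \<partial>lborel)" rule: ennreal_cases)
    case (real r)
    then show ?thesis
      unfolding Lnorm_def eq ennreal_powr_def
      by (simp add: ennreal_power powr_half_sqrt)
  next
    case top
    then show ?thesis
      unfolding Lnorm_def eq ennreal_powr_def by (simp add: power2_eq_square)
  qed
qed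

lemma Lspace_2_iff:
  "f \<in> Lspace 2 \<longleftrightarrow> f \<in> borel_measurable borel \<and> integrable lborel (\<lambda>x. (f x)\<^sup>2)"
proof -
  have "Lnorm 2 f < top \<longleftrightarrow> (Lnorm 2 f)\<^sup>2 < top"
    by (auto simp: power2_eq_square ennreal_mult_less_top less_top[symmetric] ennreal_mult_eq_top_iff)
  then show ?thesis
    by (auto simp: Lspace_def Lnorm_2_square integrable_iff_bounded)
qed

lemma Lspace_2D:
  assumes "f \<in> Lspace 2"
  shows "f \<in> borel_measurable borel" "f \<in> borel_measurable lborel"
    "integrable lborel (\<lambda>x. (f x)\<^sup>2)"
  using assms by (auto simp: Lspace_2_iff)

lemma l2norm_nonneg [simp]: "0 \<le> l2norm f"
  by (simp add: l2norm_def)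

lemma l2norm_eq_integral:
  assumes "f \<in> Lspace 2"
  shows "(l2norm f)\<^sup>2 = (\<integral>x. (f x)\<^sup>2 \<partial>lborel)" "Lnorm 2 f = ennreal (l2norm f)"
proof -
  show *: "Lnorm 2 f = ennreal (l2norm f)"
    using assms by (simp add: l2norm_def Lspace_def)
  have "ennreal ((l2norm f)\<^sup>2) = ennreal (\<integral>x. (f x)\<^sup>2 \<partial>lborel)"
    using Lnorm_2_square[of f] assms
    by (simp add: * ennreal_power nn_integral_eq_integral Lspace_2_iff)
  then show "(l2norm f)\<^sup>2 = (\<integral>x. (f x)\<^sup>2 \<partial>lborel)"
    by simp
qed

lemma Lspace_1_iff: "f \<in> Lspace 1 \<longleftrightarrow> integrable lborel f"
proof -
  have "Lnorm 1 f = (\<integral>\<^sup>+x. ennreal \<bar>f x\<bar> \<partial>lborel)"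
    by (simp add: Lnorm_def ennreal_powr_def less_top)
  then show ?thesis
    by (auto simp: Lspace_def integrable_iff_bounded)
qed

lemma integrable_mult_Lspace_2:
  assumes "f \<in> Lspace 2" "g \<in> Lspace 2"
  shows "integrable lborel (\<lambda>x. f x * g x)"
proof (rule Bochner_Integration.integrable_bound)
  show "integrable lborel (\<lambda>x. (f x)\<^sup>2 + (g x)\<^sup>2)"
    using assms by (simp add: Lspace_2D)
  show "(\<lambda>x. f x * g x) \<in> borel_measurable lborel"
    using Lspace_2D(2)[OF assms(1)] Lspace_2D(2)[OF assms(2)] by measurable
  show "AE x in lborel. norm (f x * g x) \<le> norm ((f x)\<^sup>2 + (g x)\<^sup>2)"
  proof (rule AE_I2)
    fix x
    have "2 * (\<bar>f x\<bar> * \<bar>g x\<bar>) \<le> \<bar>f x\<bar>\<^sup>2 + \<bar>g x\<bar>\<^sup>2"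
      using sum_squares_bound[of "\<bar>f x\<bar>" "\<bar>g x\<bar>"] by (simp add: mult.assoc)
    moreover have "0 \<le> \<bar>f x\<bar> * \<bar>g x\<bar>"
      by simp
    ultimately have "\<bar>f x\<bar> * \<bar>g x\<bar> \<le> \<bar>f x\<bar>\<^sup>2 + \<bar>g x\<bar>\<^sup>2"
      by linarith
    then show "norm (f x * g x) \<le> norm ((f x)\<^sup>2 + (g x)\<^sup>2)"
      by (simp add: abs_mult)
  qed
qed

lemma Lspace_2_linear:
  assumes "f \<in> Lspace 2" "g \<in> Lspace 2"
  shows "(\<lambda>x. f x + g x) \<in> Lspace 2" "(\<lambda>x. f x - g x) \<in> Lspace 2" "(\<lambda>x. c * f x) \<in> Lspace 2"
    "(\<lambda>x. f x / c) \<in> Lspace 2"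
  using assms integrable_mult_Lspace_2[OF assms]
  by (auto simp: Lspace_2_iff power2_sum power2_diff power_mult_distrib power_divide mult.assoc)

lemma l2norm_scale: "l2norm (\<lambda>x. f x / c) = l2norm f / \<bar>c\<bar>" if "f \<in> Lspace 2"
proof -
  have "(l2norm (\<lambda>x. f x / c))\<^sup>2 = (l2norm f / \<bar>c\<bar>)\<^sup>2"
    using that by (simp add: l2norm_eq_integral Lspace_2_linear power_divide)
  then show ?thesis
    by (simp add: power2_eq_iff_nonneg)
qed

lemma l2norm_minus_commute: "l2norm (\<lambda>x. f x - g x) = l2norm (\<lambda>x. g x - f x)"
  by (simp add: l2norm_def Lnorm_def abs_minus_commute)

lemma l2_Cauchy_Schwarz:
  assumes f: "f \<in> Lspace 2" and g: "g \<in> Lspace 2"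
  shows "\<bar>\<integral>x. f x * g x \<partial>lborel\<bar> \<le> l2norm f * l2norm g"
proof -
  note [measurable] = Lspace_2D(1,2)[OF f] Lspace_2D(1,2)[OF g]
  have int: "integrable lborel (\<lambda>x. \<bar>f x * g x\<bar>)"
    using integrable_mult_Lspace_2[OF f g] by simp
  define I where "I = (\<integral>x. \<bar>f x * g x\<bar> \<partial>lborel)"
  have "ennreal I = (\<integral>\<^sup>+x. ennreal \<bar>f x\<bar> * ennreal \<bar>g x\<bar> \<partial>lborel)"
    using int unfolding I_def
    by (subst nn_integral_eq_integral[symmetric]) (simp_all add: abs_mult ennreal_mult)
  then have "(ennreal I)\<^sup>2 \<le> (\<integral>\<^sup>+x. (ennreal \<bar>f x\<bar>)\<^sup>2 \<partial>lborel) * (\<integral>\<^sup>+x. (ennreal \<bar>g x\<bar>)\<^sup>2 \<partial>lborel)"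
    by (simp add: Cauchy_Schwarz_nn_integral)
  also have "\<dots> = ennreal ((l2norm f * l2norm g)\<^sup>2)"
    using f g by (simp add: ennreal_power Lnorm_2_square[symmetric] l2norm_eq_integral(2)
        ennreal_mult[symmetric] power_mult_distrib)
  finally have "I\<^sup>2 \<le> (l2norm f * l2norm g)\<^sup>2"
    by (simp add: ennreal_power I_def)
  then have "I \<le> l2norm f * l2norm g"
    by (rule power2_le_imp_le) simp
  then show ?thesis
    using integral_abs_bound[of lborel "\<lambda>x. f x * g x"] unfolding I_def by linarith
qed

lemma l2norm_triangle:
  assumes f: "f \<in> Lspace 2" and g: "g \<in> Lspace 2"
  shows "l2norm (\<lambda>x. f x + g x) \<le> l2norm f + l2norm g"
proof -
  have "(l2norm (\<lambda>x. f x + g x))\<^sup>2 = (l2norm f)\<^sup>2 + (l2norm g)\<^sup>2 + 2 * (\<integral>x. f x * g x \<partial>lborel)"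
    using f g integrable_mult_Lspace_2[OF f g]
    by (simp add: l2norm_eq_integral Lspace_2_linear power2_sum mult.assoc Lspace_2D)
  also have "\<dots> \<le> (l2norm f + l2norm g)\<^sup>2"
    using l2_Cauchy_Schwarz[OF f g] by (simp add: power2_sum abs_le_iff)
  finally show ?thesis
    by (rule power2_le_imp_le) simp
qed

lemma l2norm_triangle_diff:
  assumes "f \<in> Lspace 2" "g \<in> Lspace 2" "h \<in> Lspace 2"
  shows "l2norm (\<lambda>x. f x - g x) \<le> l2norm (\<lambda>x. f x - h x) + l2norm (\<lambda>x. h x - g x)"
  using l2norm_triangle[OF Lspace_2_linear(2)[OF assms(1,3)] Lspace_2_linear(2)[OF assms(3,2)]] by simp

section \<open>Existence of measurable estimators\<close>

lemma measurable_l2_test_component: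
  assumes "p \<in> borel_measurable borel" "q \<in> borel_measurable borel" "i < n"
  shows "(\<lambda>X. l2_test R p q (X i)) \<in> borel_measurable (PiM {..<n} (\<lambda>_. borel))"
proof -
  have "l2_test R p q \<in> borel_measurable borel"
    using assms(1,2) unfolding l2_test_def[abs_def] l2_direction_def[abs_def] by measurable
  then show ?thesis
    using assms(3) by (intro measurable_compose[OF measurable_component_singleton]) auto
qed

text \<open>
  The statistic vanishes at \<open>q = p\<close>, so its infimum over the model is non-negative and, when it is
  finite, is attained up to \<open>\<epsilon>\<close>. Countability of the model keeps all suprema and the selection
  measurable.
\<close>

lemma l2_estimator_exists:
  fixes M :: "('a::euclidean_space \<Rightarrow> real) set"
  assumes M: "l2_model M R" and eps: "0 < \<epsilon>"
  shows "\<exists>phat. l2_estimator M R \<epsilon> n phat"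
proof -
  define N where "N = PiM {..<n} (\<lambda>_. borel :: 'a measure)"
  define I where "I X = (INF p\<in>M. l2_stat M R n X p)" for X
  define e where "e = from_nat_into M"
  define good where "good X k \<longleftrightarrow> l2_stat M R n X (e k) \<le> I X + ereal \<epsilon>" for X k
  have count: "countable M" and ne: "M \<noteq> {}" and meas: "\<And>p. p \<in> M \<Longrightarrow> p \<in> borel_measurable borel"
    using M by (auto simp: l2_model_def Lspace_def)
  have e: "e k \<in> M" for k
    using ne by (simp add: e_def from_nat_into)
  have stat [measurable]: "(\<lambda>X. l2_stat M R n X p) \<in> borel_measurable N" if "p \<in> M" for p
    unfolding l2_stat_def N_def using count meas that
    by (intro borel_measurable_SUP borel_measurable_ereal borel_measurable_sum
        measurable_l2_test_component) auto
  have I [measurable]: "I \<in> borel_measurable N"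
    unfolding I_def[abs_def] using count stat by (intro borel_measurable_INF) auto
  have [measurable]: "Measurable.pred N (\<lambda>X. good X k)" for k
    unfolding good_def using stat[OF e[of k]]
      borel_measurable_ereal_add[OF I borel_measurable_const[of "ereal \<epsilon>"]]
    unfolding pred_def by (rule borel_measurable_le)
  have ex: "\<exists>k. good X k" for X
  proof -
    have "0 \<le> l2_stat M R n X p" if "p \<in> M" for p
    proof -
      have "ereal (\<Sum>i<n. l2_test R p p (X i)) \<le> l2_stat M R n X p"
        unfolding l2_stat_def using that by (rule SUP_upper)
      then show ?thesis
        by (simp add: l2_test_def l2_direction_def zero_ereal_def)
    qed
    then have "0 \<le> I X"
      unfolding I_def by (rule INF_greatest)
    have "\<exists>p\<in>M. l2_stat M R n X p \<le> I X + ereal \<epsilon>"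
    proof (cases "I X = \<infinity>")
      case True
      then show ?thesis
        using ne by auto
    next
      case False
      then have "I X < I X + ereal \<epsilon>"
        using \<open>0 \<le> I X\<close> eps by (cases "I X") auto
      then obtain p where "p \<in> M" "l2_stat M R n X p < I X + ereal \<epsilon>"
        unfolding I_def INF_less_iff by blast
      then show ?thesis
        by (auto intro: less_imp_le)
    qed
    then show ?thesis
      unfolding good_def e_def using from_nat_into_surj[OF count] by metis
  qed
  \<comment> \<open>The first near-minimiser along an enumeration of the model is a measurable choice.\<close>
  define phat where "phat X = e (LEAST k. good X k)" for X
  have "phat \<in> measurable N (count_space M)"
    unfolding phat_def[abs_def]
    by (rule measurable_compose[of _ _ "count_space UNIV"]) (auto simp: e)
  moreover have "l2_stat M R n X (phat X) \<le> I X + ereal \<epsilon>" for X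
    using LeastI_ex[OF ex[of X]] by (simp add: phat_def good_def)
  ultimately show ?thesis
    using M unfolding l2_estimator_def N_def I_def by blast
qed

section \<open>The deterministic oracle inequality\<close>

text \<open>
  The model consists of functions rather than classes, so the norm of a difference could vanish
  without the difference doing so; the bound on the supremum norm excludes this.
\<close>

lemma l2_model_norm_pos:
  assumes "l2_model M R" "p \<in> M" "q \<in> M" "p \<noteq> q"
  shows "0 < l2norm (\<lambda>x. p x - q x)"
proof (rule ccontr)
  assume "\<not> 0 < l2norm (\<lambda>x. p x - q x)"
  then have "l2norm (\<lambda>x. p x - q x) = 0"
    using l2norm_nonneg[of "\<lambda>x. p x - q x"] by linarith
  moreover have "(\<lambda>x. p x - q x) \<in> Lspace 2"
    using assms by (auto simp: l2_model_def intro: Lspace_2_linear)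
  ultimately have "sup_norm (\<lambda>x. p x - q x) \<le> 0"
    using assms l2norm_eq_integral(2)[of "\<lambda>x. p x - q x"] by (fastforce simp: l2_model_def)
  then have "\<And>x. ennreal \<bar>p x - q x\<bar> \<le> 0"
    unfolding sup_norm_def by (metis SUP_le_iff UNIV_I)
  then show False
    using assms(4) by auto
qed

lemma l2_direction_in_Lspace_2:
  assumes "l2_model M R" "p \<in> M" "q \<in> M"
  shows "l2_direction p q \<in> Lspace 2"
proof -
  have "(\<lambda>x. (p x - q x) / c) \<in> Lspace 2" for c
    using assms by (intro Lspace_2_linear(2,4)) (auto simp: l2_model_def)
  moreover have "(\<lambda>x. 0) \<in> Lspace 2"
    by (simp add: Lspace_2_iff)
  ultimately show ?thesis
    by (cases "p = q") (simp_all add: l2_direction_def[abs_def])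
qed

text \<open>
  The mean of the test statistic tells which of p and q is closer to the target t, because
  \<open>2 \<langle>p - q, (p + q) / 2 - t\<rangle> = \<bar>t - p\<bar>\<^sup>2 - \<bar>t - q\<bar>\<^sup>2\<close>.
\<close>

lemma l2_direction_polarization:
  assumes M: "l2_model M R" and pq: "p \<in> M" "q \<in> M" "p \<noteq> q" and t: "t \<in> Lspace 2"
  shows "(\<integral>y. l2_direction p q y * ((p y + q y) / 2) \<partial>lborel) - (\<integral>y. l2_direction p q y * t y \<partial>lborel)
    = ((l2norm (\<lambda>x. t x - p x))\<^sup>2 - (l2norm (\<lambda>x. t x - q x))\<^sup>2) / (2 * l2norm (\<lambda>x. p x - q x))"
proof -
  have p: "p \<in> Lspace 2" and q: "q \<in> Lspace 2"
    using M pq by (auto simp: l2_model_def)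
  let ?N = "l2norm (\<lambda>x. p x - q x)"
  have "(\<integral>y. l2_direction p q y * ((p y + q y) / 2) \<partial>lborel) - (\<integral>y. l2_direction p q y * t y \<partial>lborel)
     = (\<integral>y. l2_direction p q y * ((p y + q y) / 2) - l2_direction p q y * t y \<partial>lborel)"
    using l2_direction_in_Lspace_2[OF M pq(1,2)] p q t
    by (intro Bochner_Integration.integral_diff[symmetric] integrable_mult_Lspace_2)
       (auto intro: Lspace_2_linear)
  also have "\<dots> = (\<integral>y. ((t y - p y)\<^sup>2 - (t y - q y)\<^sup>2) / (2 * ?N) \<partial>lborel)"
    using pq(3) l2_model_norm_pos[OF M pq]
    by (intro Bochner_Integration.integral_cong refl)
       (simp add: l2_direction_def l2norm_def[symmetric] power2_eq_square field_simps)
  also have "\<dots> = ((l2norm (\<lambda>x. t x - p x))\<^sup>2 - (l2norm (\<lambda>x. t x - q x))\<^sup>2) / (2 * ?N)"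
    using p q t by (simp add: l2norm_eq_integral Lspace_2_linear Lspace_2D)
  finally show ?thesis .
qed

text \<open>
  The statistic splits into its mean, computed by polarization, and the centred empirical process
  in the direction of \<open>p - q\<close>.
\<close>

lemma l2_test_sum:
  assumes M: "l2_model M R" and pq: "p \<in> M" "q \<in> M" "p \<noteq> q" and t: "t \<in> Lspace 2" and n: "n \<ge> 1"
  shows "(\<Sum>i<n. l2_test R p q (X i)) = real n / (2 * R) *
    (((l2norm (\<lambda>x. t x - p x))\<^sup>2 - (l2norm (\<lambda>x. t x - q x))\<^sup>2) / (2 * l2norm (\<lambda>x. p x - q x))
      - ((\<Sum>i<n. l2_direction p q (X i)) / real n - (\<integral>y. l2_direction p q y * t y \<partial>lborel)))"
proof -
  have "(\<Sum>i<n. l2_test R p q (X i)) = 1 / (2 * R) *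
     (real n * (\<integral>y. l2_direction p q y * ((p y + q y) / 2) \<partial>lborel) - (\<Sum>i<n. l2_direction p q (X i)))"
    by (simp add: l2_test_def sum_distrib_left[symmetric] sum_subtractf sum_divide_distrib[symmetric])
  also have "(\<integral>y. l2_direction p q y * ((p y + q y) / 2) \<partial>lborel)
     = ((l2norm (\<lambda>x. t x - p x))\<^sup>2 - (l2norm (\<lambda>x. t x - q x))\<^sup>2) / (2 * l2norm (\<lambda>x. p x - q x))
      + (\<integral>y. l2_direction p q y * t y \<partial>lborel)"
    using l2_direction_polarization[OF M pq t] by linarith
  finally show ?thesis
    using n by (simp add: algebra_simps add_divide_distrib diff_divide_distrib)
qed

text \<open>
  Write a and b for the distances of t to p and to the estimator. By the triangle inequality
  \<open>(a\<^sup>2 - v\<^sup>2) / (2 \<bar>p - q\<bar>) \<le> a\<close> when v is the distance of t to q, so the statistic of p is at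
  most of order \<open>a + Z\<close>. Comparing the estimator with p shows that its statistic is at least of
  order \<open>(b - a) / 2 - Z\<close>. As the estimator nearly minimises the statistic, b is at most of the
  order of a and Z.
\<close>

lemma l2_estimator_oracle_inequality:
  assumes est: "l2_estimator M R \<epsilon> n phat" and n: "n \<ge> 1"
    and t: "t \<in> Lspace 2" and p: "p \<in> M" and X: "X \<in> space (PiM {..<n} (\<lambda>_. borel))" and eps: "0 < \<epsilon>"
    and Z: "\<And>p q. p \<in> M \<Longrightarrow> q \<in> M \<Longrightarrow>
      \<bar>(\<Sum>i<n. l2_direction p q (X i)) / real n - (\<integral>y. l2_direction p q y * t y \<partial>lborel)\<bar> \<le> Z"
  shows "l2norm (\<lambda>x. t x - phat X x) \<le> 3 * l2norm (\<lambda>x. t x - p x) + 4 * Z + 4 * R * \<epsilon> / real n"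
proof -
  have M: "l2_model M R" and "phat X \<in> M"
    and near: "l2_stat M R n X (phat X) \<le> (INF p\<in>M. l2_stat M R n X p) + ereal \<epsilon>"
    using est X measurable_space[of phat "PiM {..<n} (\<lambda>_. borel)" "count_space M" X]
    by (auto simp: l2_estimator_def)
  have R: "0 < R" and L2: "\<And>p. p \<in> M \<Longrightarrow> p \<in> Lspace 2"
    using M by (auto simp: l2_model_def)
  define a where "a = l2norm (\<lambda>x. t x - p x)"
  define b where "b = l2norm (\<lambda>x. t x - phat X x)"
  define c where "c = real n / (2 * R)"
  have c: "0 < c" and a0: "0 \<le> a" and b0: "0 \<le> b"
    using R n by (simp_all add: c_def a_def b_def)
  have Z0: "0 \<le> Z"
    using Z[OF p p] by linarith
  have "l2_stat M R n X p \<le> ereal (c * (a + Z))"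
    unfolding l2_stat_def
  proof (rule SUP_least)
    fix q assume q: "q \<in> M"
    show "ereal (\<Sum>i<n. l2_test R p q (X i)) \<le> ereal (c * (a + Z))"
    proof (cases "p = q")
      case True
      then show ?thesis
        using c Z0 by (simp add: l2_test_def l2_direction_def a_def)
    next
      case False
      define v where "v = l2norm (\<lambda>x. t x - q x)"
      define N where "N = l2norm (\<lambda>x. p x - q x)"
      have N: "0 < N"
        unfolding N_def by (rule l2_model_norm_pos[OF M p q False])
      have v: "0 \<le> v"
        by (simp add: v_def)
      have "a \<le> v + N"
        unfolding a_def v_def N_def using l2norm_triangle_diff[OF t L2[OF p] L2[OF q]]
        by (simp add: l2norm_minus_commute[of q])
      have "(a\<^sup>2 - v\<^sup>2) / (2 * N) \<le> a"
      proof (cases "a \<le> v")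
        case True
        then have "a\<^sup>2 \<le> v\<^sup>2"
          using a0 by (simp add: power_mono)
        then have "(a\<^sup>2 - v\<^sup>2) / (2 * N) \<le> 0"
          using N by (simp add: divide_le_0_iff)
        then show ?thesis
          using a0 by linarith
      next
        case False
        have "a\<^sup>2 - v\<^sup>2 = (a - v) * (a + v)"
          by (simp add: power2_eq_square algebra_simps)
        also have "\<dots> \<le> N * (2 * a)"
          using False \<open>a \<le> v + N\<close> v N by (intro mult_mono) auto
        finally show ?thesis
          using N by (simp add: field_simps)
      qed
      then have "(\<Sum>i<n. l2_test R p q (X i)) \<le> c * (a + Z)"
        unfolding l2_test_sum[OF M p q False t n] c_def[symmetric]
        using Z[OF p q] c by (intro mult_left_mono) (auto simp: a_def v_def N_def)
      then show ?thesis
        by simp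
    qed
  qed
  moreover have "(INF p\<in>M. l2_stat M R n X p) \<le> l2_stat M R n X p"
    using p by (rule INF_lower)
  ultimately have upper: "l2_stat M R n X (phat X) \<le> ereal (c * (a + Z) + \<epsilon>)"
    using near by (metis (no_types, lifting) add_right_mono order_trans plus_ereal.simps(1))
  show ?thesis
  proof (cases "phat X = p \<or> b \<le> a")
    case True
    then have "b \<le> a"
      by (auto simp: a_def b_def)
    moreover have "0 \<le> 4 * R * \<epsilon> / real n"
      using R eps by simp
    ultimately show ?thesis
      using Z0 a0 unfolding a_def[symmetric] b_def[symmetric] by linarith
  next
    case False
    define N where "N = l2norm (\<lambda>x. phat X x - p x)"
    have N: "0 < N"
      unfolding N_def using False by (intro l2_model_norm_pos[OF M \<open>phat X \<in> M\<close> p]) auto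
    have "N \<le> b + a"
      unfolding a_def b_def N_def using l2norm_triangle_diff[OF L2[OF \<open>phat X \<in> M\<close>] L2[OF p] t]
      by (simp add: l2norm_minus_commute[of "phat X" t])
    have "(b - a) * N \<le> (b - a) * (b + a)"
      using \<open>N \<le> b + a\<close> False by (intro mult_left_mono) auto
    also have "\<dots> = b\<^sup>2 - a\<^sup>2"
      by (simp add: power2_eq_square algebra_simps)
    finally have "(b - a) / 2 \<le> (b\<^sup>2 - a\<^sup>2) / (2 * N)"
      using N by (simp add: pos_le_divide_eq)
    then have "(b - a) / 2 - Z \<le> (b\<^sup>2 - a\<^sup>2) / (2 * N)
      - ((\<Sum>i<n. l2_direction (phat X) p (X i)) / real n - (\<integral>y. l2_direction (phat X) p y * t y \<partial>lborel))"
      using Z[OF \<open>phat X \<in> M\<close> p] by linarith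
    moreover have "phat X \<noteq> p"
      using False by simp
    ultimately have "c * ((b - a) / 2 - Z) \<le> (\<Sum>i<n. l2_test R (phat X) p (X i))"
      using l2_test_sum[OF M \<open>phat X \<in> M\<close> p _ t n, of X] c
      by (simp add: c_def[symmetric] a_def[symmetric] b_def[symmetric] N_def[symmetric] mult_left_mono)
    moreover have "ereal (\<Sum>i<n. l2_test R (phat X) p (X i)) \<le> l2_stat M R n X (phat X)"
      unfolding l2_stat_def using p by (rule SUP_upper)
    ultimately have "c * ((b - a) / 2 - Z) \<le> c * (a + Z) + \<epsilon>"
      using upper by (metis ereal_less_eq(3) order_trans)
    also have "c * (a + Z) + \<epsilon> = c * (a + Z + \<epsilon> / c)"
      using c by (simp add: distrib_left)
    finally have "(b - a) / 2 - Z \<le> a + Z + \<epsilon> / c"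
      using c by simp
    moreover have "4 * R * \<epsilon> / real n = 2 * (\<epsilon> / c)"
      by (simp add: c_def)
    moreover have "(b - a) / 2 = b / 2 - a / 2"
      by (rule diff_divide_distrib)
    ultimately show ?thesis
      unfolding a_def[symmetric] b_def[symmetric] by linarith
  qed
qed

section \<open>Smoothing by a bounded continuous kernel\<close>

text \<open>
  The substitutions below use \<open>c = 1\<close> for translations, \<open>c = -1\<close> for reflections and
  \<open>c = k \<delta>\<close> to pass between a kernel of bandwidth \<open>k \<delta>\<close> and the unit bump.
\<close>

lemma nn_integral_lborel_affine:
  fixes f :: "'a::euclidean_space \<Rightarrow> ennreal"
  assumes [measurable]: "f \<in> borel_measurable borel" and c: "c \<noteq> 0"
  shows "(\<integral>\<^sup>+x. f x \<partial>lborel) = ennreal (\<bar>c\<bar> ^ DIM('a)) * (\<integral>\<^sup>+x. f (t + c *\<^sub>R x) \<partial>lborel)"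
  by (subst lborel_affine[OF c, of t])
     (simp add: nn_integral_density nn_integral_distr nn_integral_cmult)

lemma integral_lborel_affine:
  fixes f :: "'a::euclidean_space \<Rightarrow> real"
  assumes [measurable]: "f \<in> borel_measurable borel" and c: "c \<noteq> 0"
  shows "(\<integral>x. f x \<partial>lborel) = \<bar>c\<bar> ^ DIM('a) * (\<integral>x. f (t + c *\<^sub>R x) \<partial>lborel)"
  by (subst lborel_affine[OF c, of t]) (simp add: integral_density integral_distr)

lemma integrable_lborel_affine:
  fixes f :: "'a::euclidean_space \<Rightarrow> real"
  assumes f: "integrable lborel f" and c: "c \<noteq> 0"
  shows "integrable lborel (\<lambda>x. f (t + c *\<^sub>R x))"
proof -
  have [measurable]: "f \<in> borel_measurable borel"
    using f by simp
  have "ennreal (\<bar>c\<bar> ^ DIM('a)) * (\<integral>\<^sup>+x. ennreal (norm (f (t + c *\<^sub>R x))) \<partial>lborel) < \<infinity>"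
    using f c nn_integral_lborel_affine[of "\<lambda>x. ennreal (norm (f x))" c t]
    by (simp add: integrable_iff_bounded)
  then have "(\<integral>\<^sup>+x. ennreal (norm (f (t + c *\<^sub>R x))) \<partial>lborel) < \<infinity>"
    using c by (auto simp: ennreal_mult_less_top)
  then show ?thesis
    by (simp add: integrable_iff_bounded)
qed

definition kernel_smooth :: "('a::euclidean_space \<Rightarrow> real) \<Rightarrow> ('a \<Rightarrow> real) \<Rightarrow> 'a \<Rightarrow> real" where
  "kernel_smooth \<kappa> f x = (\<integral>y. f y * \<kappa> (y - x) \<partial>lborel)"

text \<open>
  Of the kernel only \<open>\<bar>\<kappa>\<bar>\<^sub>2\<^sup>2 \<le> A B\<close> enters the risk. Boundedness and continuity make the smoothed
  function defined at every point and continuous, as befits models that consist of functions.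
\<close>

locale bounded_kernel =
  fixes \<kappa> :: "'a::euclidean_space \<Rightarrow> real" and A B :: real
  assumes kernel_continuous: "continuous_on UNIV \<kappa>"
    and kernel_bound: "\<And>z. \<bar>\<kappa> z\<bar> \<le> B"
    and kernel_integrable: "integrable lborel \<kappa>"
    and kernel_L1: "(\<integral>z. \<bar>\<kappa> z\<bar> \<partial>lborel) \<le> A"
begin

lemma kernel_measurable [measurable]: "\<kappa> \<in> borel_measurable borel"
  using kernel_continuous by (rule borel_measurable_continuous_onI)

lemma kernel_constants_nonneg: "0 \<le> B" "0 \<le> A"
proof -
  show "0 \<le> B"
    using kernel_bound[of 0] by linarith
  have "0 \<le> (\<integral>z. \<bar>\<kappa> z\<bar> \<partial>lborel)"
    by simp
  then show "0 \<le> A"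
    using kernel_L1 by linarith
qed

lemma kernel_L2: "(\<integral>\<^sup>+z. ennreal ((\<kappa> z)\<^sup>2) \<partial>lborel) \<le> ennreal (A * B)"
proof -
  have "(\<integral>\<^sup>+z. ennreal ((\<kappa> z)\<^sup>2) \<partial>lborel) \<le> (\<integral>\<^sup>+z. ennreal B * ennreal \<bar>\<kappa> z\<bar> \<partial>lborel)"
  proof (rule nn_integral_mono)
    fix z
    have "(\<kappa> z)\<^sup>2 = \<bar>\<kappa> z\<bar> * \<bar>\<kappa> z\<bar>"
      by (simp add: power2_eq_square)
    also have "\<dots> \<le> B * \<bar>\<kappa> z\<bar>"
      using kernel_bound by (intro mult_right_mono) auto
    finally show "ennreal ((\<kappa> z)\<^sup>2) \<le> ennreal B * ennreal \<bar>\<kappa> z\<bar>"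
      using kernel_constants_nonneg by (simp add: ennreal_mult[symmetric] ennreal_leI)
  qed
  also have "\<dots> = ennreal B * ennreal (\<integral>z. \<bar>\<kappa> z\<bar> \<partial>lborel)"
    using kernel_integrable by (simp add: nn_integral_cmult nn_integral_eq_integral)
  also have "\<dots> \<le> ennreal (A * B)"
    using kernel_constants_nonneg kernel_L1
    by (simp add: ennreal_mult[symmetric] mult.commute[of A] mult_left_mono ennreal_leI)
  finally show ?thesis .
qed

lemma kernel_L2_shift:
  "(\<integral>\<^sup>+y. ennreal ((\<kappa> (y - x))\<^sup>2) \<partial>lborel) \<le> ennreal (A * B)"
  using kernel_L2 nn_integral_lborel_affine[of "\<lambda>z. ennreal ((\<kappa> z)\<^sup>2)" 1 "- x"] by simp

lemma kernel_shift_Lspace_2: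
  "(\<lambda>y. \<kappa> (y - x)) \<in> Lspace 2" "l2norm (\<lambda>y. \<kappa> (y - x)) \<le> sqrt (A * B)"
proof -
  have "(\<integral>\<^sup>+y. ennreal ((\<kappa> (y - x))\<^sup>2) \<partial>lborel) < \<infinity>"
    using kernel_L2_shift[of x] by (simp add: order_le_less_trans)
  then show L2: "(\<lambda>y. \<kappa> (y - x)) \<in> Lspace 2"
    by (simp add: Lspace_2_iff integrable_iff_bounded)
  have "ennreal ((l2norm (\<lambda>y. \<kappa> (y - x)))\<^sup>2) \<le> ennreal (A * B)"
    using kernel_L2_shift[of x] L2
    by (simp add: Lnorm_2_square[symmetric] l2norm_eq_integral(2) ennreal_power)
  then show "l2norm (\<lambda>y. \<kappa> (y - x)) \<le> sqrt (A * B)"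
    using kernel_constants_nonneg by (simp add: real_le_rsqrt)
qed

lemma integrable_mult_kernel:
  assumes "integrable lborel f"
  shows "integrable lborel (\<lambda>y. f y * \<kappa> (y - x))"
proof (rule Bochner_Integration.integrable_bound)
  show "integrable lborel (\<lambda>y. B * f y)"
    using assms by simp
  show "(\<lambda>y. f y * \<kappa> (y - x)) \<in> borel_measurable lborel"
    using assms by measurable
  show "AE y in lborel. norm (f y * \<kappa> (y - x)) \<le> norm (B * f y)"
    using kernel_bound kernel_constants_nonneg
    by (intro AE_I2) (simp add: abs_mult mult.commute[of B] mult_left_mono)
qed

lemma kernel_smooth_diff:
  assumes "integrable lborel f" "integrable lborel g"
  shows "kernel_smooth \<kappa> (\<lambda>y. f y - g y) x = kernel_smooth \<kappa> f x - kernel_smooth \<kappa> g x"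
  using assms integrable_mult_kernel unfolding kernel_smooth_def
  by (simp add: left_diff_distrib)

lemma continuous_kernel_smooth:
  assumes f: "integrable lborel f"
  shows "continuous_on UNIV (kernel_smooth \<kappa> f)"
  unfolding continuous_on_sequentially
proof (intro allI ballI impI)
  fix u :: "nat \<Rightarrow> 'a" and x assume u: "(\<forall>n. u n \<in> UNIV) \<and> u \<longlonglongrightarrow> x"
  have [measurable]: "f \<in> borel_measurable borel"
    using f by simp
  have "(\<lambda>n. \<integral>y. f y * \<kappa> (y - u n) \<partial>lborel) \<longlonglongrightarrow> (\<integral>y. f y * \<kappa> (y - x) \<partial>lborel)"
  proof (rule integral_dominated_convergence[where w="\<lambda>y. \<bar>f y\<bar> * B"])
    show "integrable lborel (\<lambda>y. \<bar>f y\<bar> * B)"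
      using f by simp
    show "AE y in lborel. (\<lambda>n. f y * \<kappa> (y - u n)) \<longlonglongrightarrow> f y * \<kappa> (y - x)"
      using u by (intro AE_I2 tendsto_mult tendsto_const tendsto_diff
          continuous_on_tendsto_compose[OF kernel_continuous]) auto
    show "\<And>n. AE y in lborel. norm (f y * \<kappa> (y - u n)) \<le> \<bar>f y\<bar> * B"
      using kernel_bound by (intro AE_I2) (simp add: abs_mult mult_left_mono)
  qed auto
  then show "((kernel_smooth \<kappa> f) \<circ> u) \<longlonglongrightarrow> kernel_smooth \<kappa> f x"
    by (simp add: kernel_smooth_def[abs_def] o_def)
qed

lemma kernel_smooth_measurable:
  assumes "integrable lborel f"
  shows "kernel_smooth \<kappa> f \<in> borel_measurable borel"
  using continuous_kernel_smooth[OF assms] by (rule borel_measurable_continuous_onI)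

lemma integrable_kernel_smooth:
  assumes f: "integrable lborel f"
  shows "integrable lborel (kernel_smooth \<kappa> f)"
proof -
  have [measurable]: "f \<in> borel_measurable borel"
    using f by simp
  have "(\<integral>\<^sup>+x. ennreal (norm (kernel_smooth \<kappa> f x)) \<partial>lborel)
     \<le> (\<integral>\<^sup>+x. (\<integral>\<^sup>+y. ennreal \<bar>f y\<bar> * ennreal \<bar>\<kappa> (y - x)\<bar> \<partial>lborel) \<partial>lborel)"
  proof (rule nn_integral_mono)
    fix x
    have "ennreal (norm (kernel_smooth \<kappa> f x)) \<le> (\<integral>\<^sup>+y. ennreal (norm (f y * \<kappa> (y - x))) \<partial>lborel)"
      unfolding kernel_smooth_def by (rule integral_norm_bound_ennreal[OF integrable_mult_kernel[OF f]])
    then show "ennreal (norm (kernel_smooth \<kappa> f x)) \<le> (\<integral>\<^sup>+y. ennreal \<bar>f y\<bar> * ennreal \<bar>\<kappa> (y - x)\<bar> \<partial>lborel)"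
      by (simp add: abs_mult ennreal_mult)
  qed
  also have "\<dots> = (\<integral>\<^sup>+y. (\<integral>\<^sup>+x. ennreal \<bar>f y\<bar> * ennreal \<bar>\<kappa> (y - x)\<bar> \<partial>lborel) \<partial>lborel)"
    by (rule lborel_pair.Fubini') measurable
  also have "\<dots> = (\<integral>\<^sup>+y. ennreal \<bar>f y\<bar> * ennreal (\<integral>z. \<bar>\<kappa> z\<bar> \<partial>lborel) \<partial>lborel)"
  proof (intro nn_integral_cong)
    fix y
    have "(\<integral>\<^sup>+x. ennreal \<bar>\<kappa> (y - x)\<bar> \<partial>lborel) = (\<integral>\<^sup>+z. ennreal \<bar>\<kappa> z\<bar> \<partial>lborel)"
      using nn_integral_lborel_affine[of "\<lambda>z. ennreal \<bar>\<kappa> z\<bar>" "-1" y] by simp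
    also have "\<dots> = ennreal (\<integral>z. \<bar>\<kappa> z\<bar> \<partial>lborel)"
      using kernel_integrable by (simp add: nn_integral_eq_integral)
    finally show "(\<integral>\<^sup>+x. ennreal \<bar>f y\<bar> * ennreal \<bar>\<kappa> (y - x)\<bar> \<partial>lborel)
       = ennreal \<bar>f y\<bar> * ennreal (\<integral>z. \<bar>\<kappa> z\<bar> \<partial>lborel)"
      by (simp add: nn_integral_cmult)
  qed
  also have "\<dots> < \<infinity>"
    using f by (simp add: nn_integral_multc nn_integral_eq_integral ennreal_mult_less_top)
  finally show ?thesis
    using kernel_smooth_measurable[OF f] by (simp add: integrable_iff_bounded)
qed

lemma kernel_smooth_Lspace_2:
  assumes f: "integrable lborel f"
  shows "kernel_smooth \<kappa> f \<in> Lspace 2"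
proof -
  define C where "C = (\<integral>y. \<bar>f y\<bar> * B \<partial>lborel)"
  have bound: "\<bar>kernel_smooth \<kappa> f x\<bar> \<le> C" for x
  proof -
    have "\<bar>kernel_smooth \<kappa> f x\<bar> \<le> (\<integral>y. \<bar>f y * \<kappa> (y - x)\<bar> \<partial>lborel)"
      unfolding kernel_smooth_def by (rule integral_abs_bound)
    also have "\<dots> \<le> C"
      unfolding C_def using f kernel_bound
      by (intro integral_mono integrable_abs integrable_mult_kernel)
         (auto simp: abs_mult mult_left_mono)
    finally show ?thesis .
  qed
  have "integrable lborel (\<lambda>x. (kernel_smooth \<kappa> f x)\<^sup>2)"
  proof (rule Bochner_Integration.integrable_bound)
    show "integrable lborel (\<lambda>x. C * kernel_smooth \<kappa> f x)"
      using integrable_kernel_smooth[OF f] by simp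
    show "(\<lambda>x. (kernel_smooth \<kappa> f x)\<^sup>2) \<in> borel_measurable lborel"
      using kernel_smooth_measurable[OF f] by simp
    show "AE x in lborel. norm ((kernel_smooth \<kappa> f x)\<^sup>2) \<le> norm (C * kernel_smooth \<kappa> f x)"
    proof (rule AE_I2)
      fix x
      have "\<bar>kernel_smooth \<kappa> f x\<bar> * \<bar>kernel_smooth \<kappa> f x\<bar> \<le> \<bar>C\<bar> * \<bar>kernel_smooth \<kappa> f x\<bar>"
        using bound[of x] by (intro mult_right_mono) auto
      then show "norm ((kernel_smooth \<kappa> f x)\<^sup>2) \<le> norm (C * kernel_smooth \<kappa> f x)"
        by (simp add: power2_eq_square abs_mult)
    qed
  qed
  then show ?thesis
    using kernel_smooth_measurable[OF f] by (simp add: Lspace_2_iff)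
qed

lemma abs_kernel_smooth_le:
  assumes "f \<in> Lspace 2"
  shows "\<bar>kernel_smooth \<kappa> f x\<bar> \<le> sqrt (A * B) * l2norm f"
proof -
  have "\<bar>kernel_smooth \<kappa> f x\<bar> \<le> l2norm f * l2norm (\<lambda>y. \<kappa> (y - x))"
    unfolding kernel_smooth_def by (rule l2_Cauchy_Schwarz[OF assms kernel_shift_Lspace_2(1)])
  also have "\<dots> \<le> l2norm f * sqrt (A * B)"
    using kernel_shift_Lspace_2(2) by (intro mult_left_mono) auto
  finally show ?thesis
    by (simp add: mult.commute)
qed

end

section \<open>The bump function\<close>

definition tent :: "'a::euclidean_space \<Rightarrow> real" where
  "tent u = max 0 (1 - norm u)"

definition tent_mass :: "'a::euclidean_space itself \<Rightarrow> real" where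
  "tent_mass _ = (\<integral>u. tent (u::'a) \<partial>lborel)"

definition bump :: "'a::euclidean_space \<Rightarrow> real" where
  "bump u = tent u / tent_mass TYPE('a)"

lemma continuous_tent: "continuous_on S tent"
  unfolding tent_def[abs_def] by (intro continuous_intros)

lemma tent_measurable [measurable]: "tent \<in> borel_measurable borel"
  using continuous_tent by (rule borel_measurable_continuous_onI)

lemma integrable_tent: "integrable lborel (tent :: 'a::euclidean_space \<Rightarrow> real)"
proof -
  have "integrable lborel (\<lambda>u::'a. indicator (cball 0 1) u *\<^sub>R tent u)"
    by (intro borel_integrable_compact continuous_tent compact_cball)
  moreover have "(\<lambda>u::'a. indicator (cball 0 1) u *\<^sub>R tent u) = tent"
    by (auto simp: tent_def indicator_def fun_eq_iff)
  ultimately show ?thesis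
    by simp
qed

lemma tent_mass_pos: "0 < tent_mass TYPE('a::euclidean_space)"
proof -
  have "0 < measure lborel (ball (0::'a) (1/2)) / 2"
    using content_ball_pos[of "1/2" "0::'a"] by simp
  also have "\<dots> = (\<integral>u. indicator (ball (0::'a) (1/2)) u / 2 \<partial>lborel)"
    by simp
  also have "\<dots> \<le> tent_mass TYPE('a)"
    unfolding tent_mass_def
  proof (rule integral_mono[OF _ integrable_tent])
    have "integrable lborel (indicator (ball (0::'a) (1/2)) :: 'a \<Rightarrow> real)"
      using emeasure_lborel_ball_finite[of "0::'a" "1/2"] by (intro integrable_real_indicator) auto
    then show "integrable lborel (\<lambda>u::'a. indicator (ball 0 (1/2)) u / (2::real))"
      by (rule integrable_divide)
    show "indicator (ball 0 (1/2)) u / 2 \<le> tent u" for u :: 'a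
      by (auto simp: tent_def indicator_def)
  qed
  finally show ?thesis .
qed

lemma bump_nonneg: "0 \<le> bump (u::'a::euclidean_space)"
  using tent_mass_pos[where 'a='a] by (simp add: bump_def tent_def less_imp_le)

lemma bump_le: "bump (u::'a::euclidean_space) \<le> 1 / tent_mass TYPE('a)"
  using tent_mass_pos[where 'a='a] by (simp add: bump_def tent_def divide_right_mono)

lemma bump_eq_0: "1 \<le> norm u \<Longrightarrow> bump u = 0"
  by (simp add: bump_def tent_def)

lemma continuous_bump: "continuous_on S (bump :: 'a::euclidean_space \<Rightarrow> real)"
  unfolding bump_def[abs_def] using tent_mass_pos[where 'a='a]
  by (intro continuous_intros continuous_tent) auto

lemma bump_measurable [measurable]: "bump \<in> borel_measurable borel"
  using continuous_bump by (rule borel_measurable_continuous_onI)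

lemma integrable_bump: "integrable lborel (bump :: 'a::euclidean_space \<Rightarrow> real)"
  unfolding bump_def[abs_def] by (rule integrable_divide[OF integrable_tent])

lemma integral_bump: "(\<integral>u. bump (u::'a::euclidean_space) \<partial>lborel) = 1"
  using tent_mass_pos[where 'a='a] by (simp add: bump_def[abs_def] tent_mass_def)

lemma integrable_mult_bump:
  fixes f :: "'a::euclidean_space \<Rightarrow> real"
  assumes f: "integrable lborel f"
  shows "integrable lborel (\<lambda>u. f u * bump u)"
proof (rule Bochner_Integration.integrable_bound)
  show "integrable lborel (\<lambda>u. f u * (1 / tent_mass TYPE('a)))"
    using f by simp
  show "(\<lambda>u. f u * bump u) \<in> borel_measurable lborel"
    using f by simp
  show "AE u in lborel. norm (f u * bump u) \<le> norm (f u * (1 / tent_mass TYPE('a)))"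
    using tent_mass_pos[where 'a='a]
    by (intro AE_I2, unfold norm_mult, intro mult_left_mono)
       (auto simp: bump_nonneg bump_le abs_of_nonneg)
qed

section \<open>The kernel of averaged finite differences\<close>

text \<open>
  Relative to the coefficient of \<open>f x\<close>, that of \<open>f (x + k h)\<close> in the difference of order m is
  \<open>(- 1) ^ k * (m choose k)\<close>; its negative appears here. The bump rescaled by \<open>k \<delta>\<close> is the density
  of \<open>k \<delta> u\<close> when u has density \<open>bump\<close>.
\<close>

definition difference_kernel :: "nat \<Rightarrow> real \<Rightarrow> 'a::euclidean_space \<Rightarrow> real" where
  "difference_kernel m \<delta> z = (\<Sum>k\<in>{1..m}. (-1) ^ (k + 1) * real (m choose k) *
     (bump ((1 / (real k * \<delta>)) *\<^sub>R z) / (real k * \<delta>) ^ DIM('a)))"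

lemma sum_choose_le: "(\<Sum>k\<in>{1..m}. real (m choose k)) \<le> 2 ^ m"
proof -
  have "(\<Sum>k\<in>{1..m}. real (m choose k)) \<le> (\<Sum>k\<le>m. real (m choose k))"
    by (rule sum_mono2) auto
  also have "\<dots> = 2 ^ m"
    using choose_row_sum[of m] by (metis of_nat_numeral of_nat_power of_nat_sum)
  finally show ?thesis .
qed

lemma scaled_bump:
  fixes c :: real
  assumes c: "0 < c"
  shows "integrable lborel (\<lambda>z::'a::euclidean_space. bump ((1 / c) *\<^sub>R z) / c ^ DIM('a))"
    and "(\<integral>z. bump ((1 / c) *\<^sub>R (z::'a)) / c ^ DIM('a) \<partial>lborel) = 1"
proof -
  let ?g = "\<lambda>z::'a. bump ((1 / c) *\<^sub>R z) / c ^ DIM('a)"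
  show "integrable lborel ?g"
    using integrable_lborel_affine[OF integrable_bump, of "1 / c" "0::'a"] c by simp
  have "(\<integral>z. ?g z \<partial>lborel) = \<bar>c\<bar> ^ DIM('a) * (\<integral>z. ?g (0 + c *\<^sub>R z) \<partial>lborel)"
    using c by (intro integral_lborel_affine) auto
  also have "(\<lambda>z. ?g (0 + c *\<^sub>R z)) = (\<lambda>z. bump z / c ^ DIM('a))"
    using c by simp
  also have "\<bar>c\<bar> ^ DIM('a) * (\<integral>z. bump (z::'a) / c ^ DIM('a) \<partial>lborel) = 1"
    using c by (simp add: integral_bump)
  finally show "(\<integral>z. ?g z \<partial>lborel) = 1" .
qed

text \<open>
  Each rescaled bump has mass one and height at most \<open>1 / (tent_mass * \<delta>\<^sup>d)\<close>, as \<open>k \<ge> 1\<close>, and the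
  binomial coefficients add up to at most \<open>2\<^sup>m\<close>.
\<close>

lemma bounded_kernel_difference_kernel:
  assumes \<delta>: "0 < \<delta>"
  shows "bounded_kernel (difference_kernel m \<delta> :: 'a::euclidean_space \<Rightarrow> real) (2 ^ m)
     (2 ^ m / tent_mass TYPE('a) / \<delta> ^ DIM('a))"
proof
  let ?b = "\<lambda>k (z::'a). bump ((1 / (real k * \<delta>)) *\<^sub>R z) / (real k * \<delta>) ^ DIM('a)"
  have b0: "0 \<le> ?b k z" for k z
    using \<delta> by (simp add: bump_nonneg)
  have abs: "\<bar>difference_kernel m \<delta> z\<bar> \<le> (\<Sum>k\<in>{1..m}. real (m choose k) * ?b k z)" for z :: 'a
    unfolding difference_kernel_def
    by (rule order_trans[OF sum_abs])
       (simp only: abs_mult abs_of_nonneg[OF b0] power_abs abs_neg_one power_one mult_1 abs_of_nat order_refl)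
  show "continuous_on UNIV (difference_kernel m \<delta> :: 'a \<Rightarrow> real)"
    unfolding difference_kernel_def[abs_def] using \<delta>
    by (intro continuous_intros continuous_on_compose2[OF continuous_bump[of UNIV]]) auto
  show "\<bar>difference_kernel m \<delta> z\<bar> \<le> 2 ^ m / tent_mass TYPE('a) / \<delta> ^ DIM('a)" for z :: 'a
  proof -
    have "(\<Sum>k\<in>{1..m}. real (m choose k) * ?b k z)
       \<le> (\<Sum>k\<in>{1..m}. real (m choose k) * (1 / tent_mass TYPE('a) / \<delta> ^ DIM('a)))"
    proof (intro sum_mono mult_left_mono)
      fix k assume k: "k \<in> {1..m}"
      have "\<delta> ^ DIM('a) \<le> (real k * \<delta>) ^ DIM('a)"
        using k \<delta> by (intro power_mono) auto
      then show "?b k z \<le> 1 / tent_mass TYPE('a) / \<delta> ^ DIM('a)"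
        using \<delta> bump_le bump_nonneg tent_mass_pos[where 'a='a] by (intro frac_le) auto
    qed auto
    also have "\<dots> = (\<Sum>k\<in>{1..m}. real (m choose k)) * (1 / tent_mass TYPE('a) / \<delta> ^ DIM('a))"
      by (rule sum_distrib_right[symmetric])
    also have "\<dots> \<le> 2 ^ m * (1 / tent_mass TYPE('a) / \<delta> ^ DIM('a))"
      using sum_choose_le tent_mass_pos[where 'a='a] \<delta> by (intro mult_right_mono) auto
    finally show ?thesis
      using abs[of z] by simp
  qed
  have int: "integrable lborel (?b k)" "(\<integral>z. ?b k z \<partial>lborel) = 1" if "k \<in> {1..m}" for k
    using scaled_bump[of "real k * \<delta>"] that \<delta> by auto
  show ik: "integrable lborel (difference_kernel m \<delta> :: 'a \<Rightarrow> real)"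
    unfolding difference_kernel_def[abs_def]
    by (intro Bochner_Integration.integrable_sum integrable_mult_right int)
  have "(\<integral>z. \<bar>difference_kernel m \<delta> (z::'a)\<bar> \<partial>lborel)
     \<le> (\<integral>z. (\<Sum>k\<in>{1..m}. real (m choose k) * ?b k z) \<partial>lborel)"
    using ik abs
    by (intro integral_mono Bochner_Integration.integrable_sum integrable_mult_right int) auto
  also have "\<dots> = (\<Sum>k\<in>{1..m}. real (m choose k) * (\<integral>z. ?b k z \<partial>lborel))"
    by (subst Bochner_Integration.integral_sum)
       (auto intro!: int integrable_mult_right simp del: divide_const_simps times_divide_eq_right)
  also have "\<dots> = (\<Sum>k\<in>{1..m}. real (m choose k))"
    by (intro sum.cong refl) (simp only: int mult_1_right)
  also have "\<dots> \<le> 2 ^ m"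
    by (rule sum_choose_le)
  finally show "(\<integral>z. \<bar>difference_kernel m \<delta> (z::'a)\<bar> \<partial>lborel) \<le> 2 ^ m" .
qed

section \<open>Finite differences and the smoothing error\<close>

lemma finite_difference_0: "finite_difference 0 h f = f"
  by (simp add: finite_difference_def)

lemma finite_difference_Suc:
  "finite_difference (Suc m) h f x = finite_difference m h f (x + h) - finite_difference m h f x"
  by (simp add: finite_difference_def)

text \<open>
  Pascal's rule, written as the inductive step for the expansion of higher differences.
\<close>

lemma binomial_difference_step:
  fixes g :: "nat \<Rightarrow> real"
  shows "(\<Sum>k\<le>m. (-1) ^ (m + k) * real (m choose k) * g (Suc k))
    - (\<Sum>k\<le>m. (-1) ^ (m + k) * real (m choose k) * g k)
    = (\<Sum>k\<le>Suc m. (-1) ^ (Suc m + k) * real (Suc m choose k) * g k)"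
proof -
  have "(\<Sum>k\<le>m. (-1) ^ (m + k) * real (m choose k) * g k)
     = (\<Sum>k\<le>Suc m. (-1) ^ (m + k) * real (m choose k) * g k)"
    by simp
  also have "\<dots> = (-1) ^ m * g 0 + (\<Sum>k\<le>m. (-1) ^ (m + Suc k) * real (m choose Suc k) * g (Suc k))"
    by (subst sum.atMost_Suc_shift) simp
  finally have low: "(\<Sum>k\<le>m. (-1) ^ (m + k) * real (m choose k) * g k)
     = (-1) ^ m * g 0 + (\<Sum>k\<le>m. (-1) ^ (m + Suc k) * real (m choose Suc k) * g (Suc k))" .
  have "(\<Sum>k\<le>Suc m. (-1) ^ (Suc m + k) * real (Suc m choose k) * g k)
     = - ((-1) ^ m * g 0) + (\<Sum>k\<le>m. (-1) ^ (m + k) * real (Suc m choose Suc k) * g (Suc k))"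
    by (subst sum.atMost_Suc_shift) simp
  also have "(\<Sum>k\<le>m. (-1) ^ (m + k) * real (Suc m choose Suc k) * g (Suc k))
     = (\<Sum>k\<le>m. (-1) ^ (m + k) * real (m choose k) * g (Suc k))
       - (\<Sum>k\<le>m. (-1) ^ (m + Suc k) * real (m choose Suc k) * g (Suc k))"
    unfolding sum_subtractf[symmetric] by (intro sum.cong refl) (simp add: algebra_simps)
  finally show ?thesis
    unfolding low by simp
qed

lemma finite_difference_expand:
  "finite_difference m h f x = (\<Sum>k\<le>m. (-1) ^ (m + k) * real (m choose k) * f (x + real k *\<^sub>R h))"
proof (induction m arbitrary: x)
  case 0
  then show ?case
    by (simp add: finite_difference_0)
next
  case (Suc m)
  have shift: "x + h + real k *\<^sub>R h = x + real (Suc k) *\<^sub>R h" for k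
    by (simp add: scaleR_add_left)
  show ?case
    unfolding finite_difference_Suc Suc.IH shift by (rule binomial_difference_step)
qed

lemma finite_difference_measurable [measurable]:
  assumes [measurable]: "f \<in> borel_measurable borel"
  shows "finite_difference m h f \<in> borel_measurable borel"
  unfolding finite_difference_expand[abs_def] by measurable

lemma finite_difference_zero_step:
  assumes "1 \<le> m"
  shows "finite_difference m 0 f x = 0"
proof -
  obtain k where "m = Suc k"
    using assms by (cases m) auto
  then show ?thesis
    by (simp add: finite_difference_Suc)
qed

lemma finite_difference_L1:
  fixes f :: "'a::euclidean_space \<Rightarrow> real"
  assumes [measurable]: "f \<in> borel_measurable borel"
  shows "(\<integral>\<^sup>+x. ennreal \<bar>finite_difference m h f x\<bar> \<partial>lborel) \<le> 2 ^ m * (\<integral>\<^sup>+x. ennreal \<bar>f x\<bar> \<partial>lborel)"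
proof (induction m)
  case 0
  then show ?case
    by (simp add: finite_difference_0)
next
  case (Suc m)
  let ?g = "finite_difference m h f"
  have "(\<integral>\<^sup>+x. ennreal \<bar>finite_difference (Suc m) h f x\<bar> \<partial>lborel)
     \<le> (\<integral>\<^sup>+x. ennreal \<bar>?g (x + h)\<bar> + ennreal \<bar>?g x\<bar> \<partial>lborel)"
    by (intro nn_integral_mono) (simp add: finite_difference_Suc flip: ennreal_plus)
  also have "\<dots> = (\<integral>\<^sup>+x. ennreal \<bar>?g (x + h)\<bar> \<partial>lborel) + (\<integral>\<^sup>+x. ennreal \<bar>?g x\<bar> \<partial>lborel)"
    by (rule nn_integral_add) measurable
  also have "(\<integral>\<^sup>+x. ennreal \<bar>?g (x + h)\<bar> \<partial>lborel) = (\<integral>\<^sup>+x. ennreal \<bar>?g x\<bar> \<partial>lborel)"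
    using nn_integral_lborel_affine[of "\<lambda>x. ennreal \<bar>?g x\<bar>" 1 h] by (simp add: add.commute)
  also have "(\<integral>\<^sup>+x. ennreal \<bar>?g x\<bar> \<partial>lborel) + (\<integral>\<^sup>+x. ennreal \<bar>?g x\<bar> \<partial>lborel)
     \<le> 2 * (2 ^ m * (\<integral>\<^sup>+x. ennreal \<bar>f x\<bar> \<partial>lborel))"
    unfolding mult_2 by (intro add_mono Suc.IH)
  finally show ?case
    by (simp add: mult.assoc)
qed

lemma finite_difference_Besov:
  assumes r: "0 \<le> r" and s: "0 < s" and [measurable]: "f \<in> borel_measurable borel"
    and f: "besov_seminorm \<alpha> s f \<le> ennreal r"
  shows "(\<integral>\<^sup>+x. ennreal (\<bar>finite_difference (nat \<lfloor>\<alpha>\<rfloor> + 1) h f x\<bar> powr s) \<partial>lborel)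
    \<le> ennreal ((r * norm h powr \<alpha>) powr s)"
proof (cases "h = 0")
  case True
  then show ?thesis
    using s by (simp add: finite_difference_zero_step)
next
  case False
  let ?I = "\<integral>\<^sup>+x. ennreal (\<bar>finite_difference (nat \<lfloor>\<alpha>\<rfloor> + 1) h f x\<bar> powr s) \<partial>lborel"
  let ?w = "norm h powr (- \<alpha>)"
  have w: "0 < ?w" and w': "norm h powr \<alpha> = 1 / ?w"
    using False by (simp_all add: powr_minus field_simps)
  have le: "ennreal ?w * ennreal_powr ?I (1 / s) \<le> ennreal r"
    using f False unfolding besov_seminorm_def Lnorm_def by (auto simp: SUP_le_iff)
  show ?thesis
  proof (cases ?I rule: ennreal_cases)
    case (real i)
    have "?w * i powr (1 / s) \<le> r"
      using le real(1) w r unfolding real(2) ennreal_powr_def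
      by (simp add: ennreal_mult[symmetric])
    then have "i powr (1 / s) \<le> r * norm h powr \<alpha>"
      using w unfolding w' by (simp add: field_simps)
    then have "(i powr (1 / s)) powr s \<le> (r * norm h powr \<alpha>) powr s"
      using s by (intro powr_mono2) auto
    then show ?thesis
      using s real(1) unfolding real(2) by (simp add: powr_powr ennreal_leI)
  next
    case top
    then show ?thesis
      using le w by (simp add: ennreal_powr_def ennreal_mult_top top_unique)
  qed
qed

text \<open>
  In the expansion of the difference the term \<open>k = 0\<close> contributes \<open>f x\<close> and each term \<open>k \<ge> 1\<close> is
  a rescaled convolution, so the averaged difference is the smoothing error.
\<close>

lemma kernel_smooth_difference_kernel:
  fixes f :: "'a::euclidean_space \<Rightarrow> real"
  assumes f: "integrable lborel f" and \<delta>: "0 < \<delta>"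
  shows "integrable lborel (\<lambda>u. finite_difference m (\<delta> *\<^sub>R u) f x * bump u)"
    and "f x - kernel_smooth (difference_kernel m \<delta>) f x
      = (-1) ^ m * (\<integral>u. finite_difference m (\<delta> *\<^sub>R u) f x * bump u \<partial>lborel)"
proof -
  have [measurable]: "f \<in> borel_measurable borel"
    using f by simp
  let ?F = "\<lambda>k u. f (x + (real k * \<delta>) *\<^sub>R u) * bump u"
  have int0: "integrable lborel (?F 0)"
    using integrable_bump[where 'a='a] by simp
  have int: "integrable lborel (?F k)" for k
    using int0 integrable_mult_bump[OF integrable_lborel_affine[OF f, of "real k * \<delta>" x]] \<delta>
    by (cases "k = 0") auto
  have fd: "finite_difference m (\<delta> *\<^sub>R u) f x * bump u
     = (\<Sum>k\<le>m. (-1) ^ (m + k) * real (m choose k) * ?F k u)" for u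
    by (simp add: finite_difference_expand sum_distrib_right mult.assoc)
  show "integrable lborel (\<lambda>u. finite_difference m (\<delta> *\<^sub>R u) f x * bump u)"
    unfolding fd by (intro Bochner_Integration.integrable_sum integrable_mult_right int)
  have "(-1) ^ m * (\<integral>u. finite_difference m (\<delta> *\<^sub>R u) f x * bump u \<partial>lborel)
     = (-1) ^ m * (\<Sum>k\<le>m. (-1) ^ (m + k) * real (m choose k) * (\<integral>u. ?F k u \<partial>lborel))"
    unfolding fd
    by (subst Bochner_Integration.integral_sum) (auto intro!: integrable_mult_right int)
  also have "\<dots> = (\<Sum>k\<le>m. (-1) ^ k * real (m choose k) * (\<integral>u. ?F k u \<partial>lborel))"
    unfolding sum_distrib_left
    by (intro sum.cong refl) (simp add: power_add mult.assoc[symmetric] power_mult_distrib[symmetric])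
  also have "{..m} = insert 0 {1..m}"
    by auto
  also have "(\<Sum>k\<in>insert 0 {1..m}. (-1) ^ k * real (m choose k) * (\<integral>u. ?F k u \<partial>lborel))
     = f x + (\<Sum>k\<in>{1..m}. (-1) ^ k * real (m choose k) * (\<integral>u. ?F k u \<partial>lborel))"
    by (simp add: integral_bump)
  finally have rhs: "(-1) ^ m * (\<integral>u. finite_difference m (\<delta> *\<^sub>R u) f x * bump u \<partial>lborel)
     = f x + (\<Sum>k\<in>{1..m}. (-1) ^ k * real (m choose k) * (\<integral>u. ?F k u \<partial>lborel))" .
  let ?b = "\<lambda>k z. bump ((1 / (real k * \<delta>)) *\<^sub>R (z::'a)) / (real k * \<delta>) ^ DIM('a)"
  have pull: "(\<integral>y. f y * ?b k (y - x) \<partial>lborel) = (\<integral>u. ?F k u \<partial>lborel)"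
    and pull_int: "integrable lborel (\<lambda>y. f y * ?b k (y - x))" if k: "k \<in> {1..m}" for k
  proof -
    have c: "0 < real k * \<delta>"
      using k \<delta> by simp
    have "(\<integral>y. f y * ?b k (y - x) \<partial>lborel)
       = \<bar>real k * \<delta>\<bar> ^ DIM('a) * (\<integral>u. f (x + (real k * \<delta>) *\<^sub>R u) * ?b k ((x + (real k * \<delta>) *\<^sub>R u) - x) \<partial>lborel)"
      using k \<delta> by (intro integral_lborel_affine) auto
    also have "(\<lambda>u. f (x + (real k * \<delta>) *\<^sub>R u) * ?b k ((x + (real k * \<delta>) *\<^sub>R u) - x))
       = (\<lambda>u. ?F k u / (real k * \<delta>) ^ DIM('a))"
      using c by auto
    also have "\<bar>real k * \<delta>\<bar> ^ DIM('a) * (\<integral>u. ?F k u / (real k * \<delta>) ^ DIM('a) \<partial>lborel) = (\<integral>u. ?F k u \<partial>lborel)"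
      using k \<delta> by simp
    finally show "(\<integral>y. f y * ?b k (y - x) \<partial>lborel) = (\<integral>u. ?F k u \<partial>lborel)" .
    show "integrable lborel (\<lambda>y. f y * ?b k (y - x))"
    proof (rule Bochner_Integration.integrable_bound)
      show "integrable lborel (\<lambda>y. f y * (1 / tent_mass TYPE('a) / (real k * \<delta>) ^ DIM('a)))"
        using f by (rule integrable_mult_left)
      show "(\<lambda>y. f y * ?b k (y - x)) \<in> borel_measurable lborel"
        by measurable
      show "AE y in lborel. norm (f y * ?b k (y - x))
         \<le> norm (f y * (1 / tent_mass TYPE('a) / (real k * \<delta>) ^ DIM('a)))"
      proof (rule AE_I2)
        fix y
        have "norm (?b k (y - x)) \<le> norm (1 / tent_mass TYPE('a) / (real k * \<delta>) ^ DIM('a))"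
          unfolding norm_divide using bump_le[of "(1 / (real k * \<delta>)) *\<^sub>R (y - x)"]
            bump_nonneg[of "(1 / (real k * \<delta>)) *\<^sub>R (y - x)"] tent_mass_pos[where 'a='a] c
          by (intro divide_right_mono) auto
        then show "norm (f y * ?b k (y - x))
           \<le> norm (f y * (1 / tent_mass TYPE('a) / (real k * \<delta>) ^ DIM('a)))"
          unfolding norm_mult by (rule mult_left_mono) simp
      qed
    qed
  qed
  have "kernel_smooth (difference_kernel m \<delta>) f x
     = (\<integral>y. (\<Sum>k\<in>{1..m}. (-1) ^ (k + 1) * real (m choose k) * (f y * ?b k (y - x))) \<partial>lborel)"
    unfolding kernel_smooth_def difference_kernel_def sum_distrib_left
    by (intro Bochner_Integration.integral_cong refl sum.cong) (simp only: mult_ac)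
  also have "\<dots> = (\<Sum>k\<in>{1..m}. (-1) ^ (k + 1) * real (m choose k) * (\<integral>y. f y * ?b k (y - x) \<partial>lborel))"
    by (subst Bochner_Integration.integral_sum)
       (auto intro!: integrable_mult_right pull_int simp del: times_divide_eq_right power_Suc power_Suc2 One_nat_def)
  also have "\<dots> = (\<Sum>k\<in>{1..m}. (-1) ^ (k + 1) * real (m choose k) * (\<integral>u. ?F k u \<partial>lborel))"
    by (intro sum.cong refl) (simp only: pull)
  also have "\<dots> = - (\<Sum>k\<in>{1..m}. (-1) ^ k * real (m choose k) * (\<integral>u. ?F k u \<partial>lborel))"
    unfolding sum_negf[symmetric] by (intro sum.cong refl) simp
  finally show "f x - kernel_smooth (difference_kernel m \<delta>) f x
      = (-1) ^ m * (\<integral>u. finite_difference m (\<delta> *\<^sub>R u) f x * bump u \<partial>lborel)"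
    unfolding rhs by simp
qed

text \<open>
  An elementary substitute for interpolation between \<open>L\<^sub>1\<close> and \<open>L\<^sub>s\<close>: the first summand dominates
  for \<open>y \<le> \<tau>\<close> and the second one for \<open>y \<ge> \<tau>\<close>.
\<close>

lemma square_le_interpolation:
  fixes y \<tau> s :: real
  assumes "0 \<le> y" "0 < \<tau>" "2 \<le> s"
  shows "y\<^sup>2 \<le> \<tau> * y + \<tau> powr (2 - s) * y powr s"
proof (cases "y \<le> \<tau>")
  case True
  then have "y * y \<le> \<tau> * y"
    using assms by (intro mult_right_mono) auto
  then show ?thesis
    by (simp add: power2_eq_square add_increasing2)
next
  case False
  have "y\<^sup>2 = y powr (2 - s) * y powr s"
    using False assms by (simp add: powr_add[symmetric])
  also have "\<dots> \<le> \<tau> powr (2 - s) * y powr s"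
    using False assms by (intro mult_right_mono powr_mono2') auto
  finally show ?thesis
    using assms by (simp add: add_increasing)
qed

text \<open>
  By Cauchy-Schwarz the squared mean over u of the differences is at most the mean of their squares.
  After exchanging the integrals it remains to bound the \<open>L\<^sub>2\<close> norm of a single difference of step
  \<open>\<delta> u\<close>, which the interpolation inequality reduces to its \<open>L\<^sub>1\<close> norm, at most \<open>2\<^sup>m\<close>, and its
  \<open>L\<^sub>s\<close> norm, at most \<open>r \<delta>\<^sup>\<alpha>\<close> since the bump vanishes outside the unit ball.
\<close>

lemma smoothing_error:
  fixes f :: "'a::euclidean_space \<Rightarrow> real"
  assumes f: "integrable lborel f" and L1: "(\<integral>\<^sup>+x. ennreal \<bar>f x\<bar> \<partial>lborel) \<le> 1"
    and s: "2 \<le> s" and \<alpha>: "0 < \<alpha>" and r: "0 < r" and \<delta>: "0 < \<delta>" and \<tau>: "0 < \<tau>"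
    and besov: "besov_seminorm \<alpha> s f \<le> ennreal r"
  defines "m \<equiv> nat \<lfloor>\<alpha>\<rfloor> + 1"
  shows "(\<integral>\<^sup>+x. ennreal ((f x - kernel_smooth (difference_kernel m \<delta>) f x)\<^sup>2) \<partial>lborel)
    \<le> ennreal (2 ^ m * \<tau> + \<tau> powr (2 - s) * (r * \<delta> powr \<alpha>) powr s)"
proof -
  have [measurable]: "f \<in> borel_measurable borel"
    using f by simp
  define D where "D u x = finite_difference m (\<delta> *\<^sub>R u) f x" for u x
  have Dm [measurable]: "(\<lambda>(x, u). D u x) \<in> borel_measurable (lborel \<Otimes>\<^sub>M lborel)"
    unfolding D_def finite_difference_expand by measurable
  have Dm1 [measurable]: "(\<lambda>u. D u x) \<in> borel_measurable borel" for x
    unfolding D_def finite_difference_expand by measurable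
  have Dm2 [measurable]: "D u \<in> borel_measurable borel" for u
    unfolding D_def[abs_def] finite_difference_expand by measurable
  have bump1: "(\<integral>\<^sup>+u. ennreal (bump (u::'a)) \<partial>lborel) = 1"
    using integrable_bump[where 'a='a] by (simp add: nn_integral_eq_integral bump_nonneg integral_bump)
  let ?V = "ennreal (2 ^ m * \<tau> + \<tau> powr (2 - s) * (r * \<delta> powr \<alpha>) powr s)"
  have pointwise: "ennreal ((f x - kernel_smooth (difference_kernel m \<delta>) f x)\<^sup>2)
     \<le> (\<integral>\<^sup>+u. ennreal (bump u) * ennreal ((D u x)\<^sup>2) \<partial>lborel)" for x
  proof -
    define J where "J = (\<integral>u. D u x * bump u \<partial>lborel)"
    have "ennreal (norm J) \<le> (\<integral>\<^sup>+u. ennreal (norm (D u x * bump u)) \<partial>lborel)"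
      unfolding J_def D_def
      by (rule integral_norm_bound_ennreal[OF kernel_smooth_difference_kernel(1)[OF f \<delta>]])
    also have "\<dots> = (\<integral>\<^sup>+u. ennreal (\<bar>D u x\<bar> * sqrt (bump u)) * ennreal (sqrt (bump u)) \<partial>lborel)"
      by (intro nn_integral_cong)
         (simp add: ennreal_mult[symmetric] abs_mult bump_nonneg mult.assoc)
    finally have "(ennreal (norm J))\<^sup>2
       \<le> (\<integral>\<^sup>+u. ennreal (\<bar>D u x\<bar> * sqrt (bump u)) * ennreal (sqrt (bump u)) \<partial>lborel)\<^sup>2"
      by (rule power_mono) simp
    also have "\<dots> \<le> (\<integral>\<^sup>+u. (ennreal (\<bar>D u x\<bar> * sqrt (bump u)))\<^sup>2 \<partial>lborel)
        * (\<integral>\<^sup>+u. (ennreal (sqrt (bump (u::'a))))\<^sup>2 \<partial>lborel)"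
      by (rule Cauchy_Schwarz_nn_integral[of "\<lambda>u. ennreal (\<bar>D u x\<bar> * sqrt (bump u))" lborel]) auto
    also have "\<dots> = (\<integral>\<^sup>+u. ennreal (bump u) * ennreal ((D u x)\<^sup>2) \<partial>lborel)"
      using bump1 by (simp add: ennreal_power power_mult_distrib bump_nonneg ennreal_mult mult.commute)
    finally have "ennreal (J\<^sup>2) \<le> (\<integral>\<^sup>+u. ennreal (bump u) * ennreal ((D u x)\<^sup>2) \<partial>lborel)"
      by (simp add: ennreal_power)
    moreover have "(f x - kernel_smooth (difference_kernel m \<delta>) f x)\<^sup>2 = J\<^sup>2"
      unfolding kernel_smooth_difference_kernel(2)[OF f \<delta>] J_def D_def
      by (simp add: power_mult_distrib power_even_eq[symmetric] power_mult[symmetric])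
    ultimately show ?thesis
      by simp
  qed
  have inner: "ennreal (bump u) * (\<integral>\<^sup>+x. ennreal ((D u x)\<^sup>2) \<partial>lborel) \<le> ennreal (bump u) * ?V" for u
  proof (cases "1 \<le> norm u")
    case True
    then show ?thesis
      by (simp add: bump_eq_0)
  next
    case False
    have "(\<integral>\<^sup>+x. ennreal ((D u x)\<^sup>2) \<partial>lborel)
       \<le> (\<integral>\<^sup>+x. ennreal \<tau> * ennreal \<bar>D u x\<bar> + ennreal (\<tau> powr (2 - s)) * ennreal (\<bar>D u x\<bar> powr s) \<partial>lborel)"
    proof (rule nn_integral_mono)
      fix x
      have "(D u x)\<^sup>2 \<le> \<tau> * \<bar>D u x\<bar> + \<tau> powr (2 - s) * \<bar>D u x\<bar> powr s"
        using square_le_interpolation[of "\<bar>D u x\<bar>" \<tau> s] \<tau> s by simp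
      then show "ennreal ((D u x)\<^sup>2)
         \<le> ennreal \<tau> * ennreal \<bar>D u x\<bar> + ennreal (\<tau> powr (2 - s)) * ennreal (\<bar>D u x\<bar> powr s)"
        using \<tau> by (simp add: ennreal_mult[symmetric] ennreal_plus[symmetric] ennreal_leI del: ennreal_plus)
    qed
    also have "\<dots> = ennreal \<tau> * (\<integral>\<^sup>+x. ennreal \<bar>D u x\<bar> \<partial>lborel)
        + ennreal (\<tau> powr (2 - s)) * (\<integral>\<^sup>+x. ennreal (\<bar>D u x\<bar> powr s) \<partial>lborel)"
      by (simp add: nn_integral_add nn_integral_cmult)
    also have "\<dots> \<le> ennreal \<tau> * ennreal (2 ^ m) + ennreal (\<tau> powr (2 - s)) * ennreal ((r * \<delta> powr \<alpha>) powr s)"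
    proof (intro add_mono mult_left_mono)
      have "(\<integral>\<^sup>+x. ennreal \<bar>D u x\<bar> \<partial>lborel) \<le> 2 ^ m * (\<integral>\<^sup>+x. ennreal \<bar>f x\<bar> \<partial>lborel)"
        unfolding D_def by (rule finite_difference_L1) measurable
      also have "\<dots> \<le> 2 ^ m * 1"
        using L1 by (rule mult_left_mono) simp
      finally show "(\<integral>\<^sup>+x. ennreal \<bar>D u x\<bar> \<partial>lborel) \<le> ennreal (2 ^ m)"
        by (simp add: ennreal_power[symmetric])
      have "(\<integral>\<^sup>+x. ennreal (\<bar>D u x\<bar> powr s) \<partial>lborel) \<le> ennreal ((r * norm (\<delta> *\<^sub>R u) powr \<alpha>) powr s)"
        unfolding D_def m_def using r s besov by (intro finite_difference_Besov) auto
      also have "\<dots> \<le> ennreal ((r * \<delta> powr \<alpha>) powr s)"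
        using False \<delta> r s \<alpha>
        by (intro ennreal_leI powr_mono2 mult_left_mono) (auto simp: mult_left_le)
      finally show "(\<integral>\<^sup>+x. ennreal (\<bar>D u x\<bar> powr s) \<partial>lborel) \<le> ennreal ((r * \<delta> powr \<alpha>) powr s)" .
    qed auto
    also have "\<dots> = ?V"
      using \<tau> by (simp add: ennreal_mult[symmetric] ennreal_plus[symmetric] mult.commute del: ennreal_plus)
    finally show ?thesis
      by (rule mult_left_mono) simp
  qed
  have "(\<integral>\<^sup>+x. ennreal ((f x - kernel_smooth (difference_kernel m \<delta>) f x)\<^sup>2) \<partial>lborel)
     \<le> (\<integral>\<^sup>+x. (\<integral>\<^sup>+u. ennreal (bump u) * ennreal ((D u x)\<^sup>2) \<partial>lborel) \<partial>lborel)"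
    by (rule nn_integral_mono) (rule pointwise)
  also have "\<dots> = (\<integral>\<^sup>+u. (\<integral>\<^sup>+x. ennreal (bump u) * ennreal ((D u x)\<^sup>2) \<partial>lborel) \<partial>lborel)"
    by (rule lborel_pair.Fubini') measurable
  also have "\<dots> \<le> (\<integral>\<^sup>+u. ennreal (bump (u::'a)) * ?V \<partial>lborel)"
    using inner by (intro nn_integral_mono) (simp add: nn_integral_cmult)
  also have "\<dots> = ?V"
    using bump1 by (simp add: nn_integral_multc)
  finally show ?thesis .
qed

section \<open>Separated sets of square integrable functions\<close>

text \<open>
  Zorn's lemma for the subsets of F whose distinct elements are pairwise related; R need not be
  symmetric, hence the two directions in the maximality clause.
\<close>

lemma maximal_pairwise_subset:
  "\<exists>S\<subseteq>F. pairwise R S \<and> (\<forall>x\<in>F. x \<in> S \<or> (\<exists>y\<in>S. \<not> (R x y \<and> R y x)))"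
proof -
  let ?A = "{S. S \<subseteq> F \<and> pairwise R S}"
  have "\<Union>C \<in> ?A" if "subset.chain ?A C" for C
  proof -
    have sub: "C \<subseteq> ?A" and ch: "\<And>S T. S \<in> C \<Longrightarrow> T \<in> C \<Longrightarrow> S \<subseteq> T \<or> T \<subseteq> S"
      using that by (auto simp: subset_chain_def)
    have "R x y" if xy: "x \<in> \<Union>C" "y \<in> \<Union>C" "x \<noteq> y" for x y
    proof -
      obtain S T where ST: "S \<in> C" "x \<in> S" "T \<in> C" "y \<in> T"
        using xy by auto
      then have "\<exists>U\<in>C. x \<in> U \<and> y \<in> U"
        using ch[of S T] by blast
      then show ?thesis
        using sub xy(3) by (auto simp: pairwise_def)
    qed
    then show ?thesis
      using sub by (auto simp: pairwise_def)
  qed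
  then have "\<exists>S\<in>?A. \<forall>T\<in>?A. S \<subseteq> T \<longrightarrow> T = S"
    by (rule subset_Zorn')
  then obtain S where S: "S \<in> ?A" and max: "\<forall>T\<in>?A. S \<subseteq> T \<longrightarrow> T = S" ..
  have "x \<in> S \<or> (\<exists>y\<in>S. \<not> (R x y \<and> R y x))" if x: "x \<in> F" for x
  proof (rule ccontr)
    assume neg: "\<not> (x \<in> S \<or> (\<exists>y\<in>S. \<not> (R x y \<and> R y x)))"
    then have far: "\<And>y. y \<in> S \<Longrightarrow> R x y \<and> R y x" and "x \<notin> S"
      by blast+
    have "S \<subseteq> F" "pairwise R S"
      using S by simp_all
    then have "insert x S \<in> ?A"
      using x far by (simp add: pairwise_insert)
    then have "insert x S = S"
      using bspec[OF max] by (simp add: subset_insertI)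
    then show False
      using \<open>x \<notin> S\<close> insertI1[of x S] by simp
  qed
  moreover have "S \<subseteq> F" "pairwise R S"
    using S by simp_all
  ultimately show ?thesis
    by blast
qed

lemma l2_tail_small:
  fixes f :: "'a::euclidean_space \<Rightarrow> real"
  assumes f: "f \<in> Lspace 2" and e: "0 < e"
  shows "\<exists>N::nat. (\<integral>x. indicator (- cball 0 (real N)) x * (f x)\<^sup>2 \<partial>lborel) < e"
proof -
  note [measurable] = Lspace_2D(1)[OF f]
  have "(\<lambda>N. \<integral>x. indicator (- cball 0 (real N)) x * (f x)\<^sup>2 \<partial>lborel) \<longlonglongrightarrow> (\<integral>x. 0 \<partial>(lborel::'a measure))"
  proof (rule integral_dominated_convergence[where w="\<lambda>x. (f x)\<^sup>2"])
    show "AE x in lborel. (\<lambda>N. indicator (- cball 0 (real N)) x * (f x)\<^sup>2) \<longlonglongrightarrow> 0"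
    proof (rule AE_I2)
      fix x :: 'a
      obtain K :: nat where K: "norm x \<le> real K"
        using real_arch_simple by blast
      have "\<forall>\<^sub>F N in sequentially. indicator (- cball 0 (real N)) x * (f x)\<^sup>2 = 0"
        using eventually_ge_at_top[of K]
      proof eventually_elim
        case (elim N)
        then have "norm x \<le> real N"
          using K by linarith
        then show ?case
          by simp
      qed
      then show "(\<lambda>N. indicator (- cball 0 (real N)) x * (f x)\<^sup>2) \<longlonglongrightarrow> 0"
        by (rule tendsto_eventually)
    qed
    show "\<And>N. AE x in lborel. norm (indicator (- cball 0 (real N)) x * (f x)\<^sup>2) \<le> (f x)\<^sup>2"
      by (intro AE_I2) (auto simp: indicator_def)
  qed (use f in \<open>auto simp: Lspace_2D\<close>)
  then have "\<forall>\<^sub>F N in sequentially. (\<integral>x. indicator (- cball 0 (real N)) x * (f x)\<^sup>2 \<partial>lborel) < e"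
    using e by (simp add: order_tendstoD)
  then show ?thesis
    by (rule eventually_happens'[OF sequentially_bot])
qed

text \<open>
  A continuous square integrable function has a small tail outside some ball and is uniformly
  continuous on it. There are countably many choices of the radius N and of the modulus of continuity
  \<open>1 / (j + 1)\<close>. For a fixed choice the values at finitely many points, rounded to multiples of
  \<open>t N\<close>, determine the function up to an \<open>L\<^sub>2\<close> error below e, hence exactly within the family.
\<close>

lemma countable_separated_continuous_L2:
  fixes U :: "('a::euclidean_space \<Rightarrow> real) set"
  assumes cont: "\<And>f. f \<in> U \<Longrightarrow> continuous_on UNIV f" and L2: "\<And>f. f \<in> U \<Longrightarrow> f \<in> Lspace 2"
    and e: "0 < e"
    and sep: "\<And>f g. f \<in> U \<Longrightarrow> g \<in> U \<Longrightarrow> f \<noteq> g \<Longrightarrow> e \<le> l2norm (\<lambda>x. f x - g x)"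
  shows "countable U"
proof -
  define v where "v N = measure lborel (cball (0::'a) (real N))" for N
  \<comment> \<open>An error of three times the mesh t on a ball of volume v costs \<open>9 t\<^sup>2 v \<le> e\<^sup>2 / 4\<close>.\<close>
  define t where "t N = e / (6 * (v N + 1))" for N
  have v0: "0 \<le> v N" for N
    by (simp add: v_def)
  then have v1: "0 < v N + 1" for N
    using v0[of N] by linarith
  have t: "0 < t N" for N
    unfolding t_def using e v1[of N] by simp
  define T where "T N j = {f \<in> U. (\<integral>x. indicator (- cball 0 (real N)) x * (f x)\<^sup>2 \<partial>lborel) < e\<^sup>2 / 16 \<and>
      (\<forall>x\<in>cball 0 (real N). \<forall>y\<in>cball 0 (real N). dist x y < 1 / real (Suc j) \<longrightarrow> \<bar>f x - f y\<bar> \<le> t N)}" for N j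
  have "U \<subseteq> (\<Union>N j. T N j)"
  proof
    fix f assume f: "f \<in> U"
    obtain N :: nat where N: "(\<integral>x. indicator (- cball 0 (real N)) x * (f x)\<^sup>2 \<partial>lborel) < e\<^sup>2 / 16"
      using l2_tail_small[OF L2[OF f], of "e\<^sup>2 / 16"] e by auto
    have "uniformly_continuous_on (cball 0 (real N)) f"
      using cont[OF f] by (intro compact_uniformly_continuous) (auto intro: continuous_on_subset)
    then obtain \<eta> where \<eta>: "\<eta> > 0"
      "\<And>x y. x \<in> cball 0 (real N) \<Longrightarrow> y \<in> cball 0 (real N) \<Longrightarrow> dist y x < \<eta> \<Longrightarrow> dist (f y) (f x) < t N"
      using t[of N] unfolding uniformly_continuous_on_def by metis
    obtain j where "inverse (real (Suc j)) < \<eta>"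
      using reals_Archimedean[OF \<eta>(1)] by auto
    then have "f \<in> T N j"
      using f N \<eta>(2) unfolding T_def
      by (auto simp: inverse_eq_divide dist_real_def intro!: less_imp_le)
    then show "f \<in> (\<Union>N j. T N j)"
      by auto
  qed
  moreover have "countable (T N j)" for N j
  proof -
    have "\<exists>k. finite k \<and> k \<subseteq> cball (0::'a) (real N) \<and> cball 0 (real N) \<subseteq> (\<Union>x\<in>k. ball x (1 / real (Suc j)))"
      by (rule compactE_image[of "cball (0::'a) (real N)" "cball 0 (real N)" "\<lambda>x. ball x (1 / real (Suc j))"])
         auto
    then obtain k where k: "finite k" "k \<subseteq> cball (0::'a) (real N)"
        "cball 0 (real N) \<subseteq> (\<Union>x\<in>k. ball x (1 / real (Suc j)))"
      by blast
    define \<Phi> where "\<Phi> f = restrict (\<lambda>x. \<lfloor>f x / t N\<rfloor>) k" for f :: "'a \<Rightarrow> real"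
    have "inj_on \<Phi> (T N j)"
    proof (rule inj_onI, rule ccontr)
      fix f g assume f: "f \<in> T N j" and g: "g \<in> T N j" and eq: "\<Phi> f = \<Phi> g" and ne: "f \<noteq> g"
      have fU: "f \<in> U" and gU: "g \<in> U"
        using f g by (auto simp: T_def)
      note [measurable] = Lspace_2D(1)[OF L2[OF fU]] Lspace_2D(1)[OF L2[OF gU]]
      let ?I = "\<lambda>x. indicator (- cball (0::'a) (real N)) x :: real"
      have close: "\<bar>f x - g x\<bar> \<le> 3 * t N" if x: "x \<in> cball 0 (real N)" for x
      proof -
        obtain c where c: "c \<in> k" "dist c x < 1 / real (Suc j)"
          using k(3) x by auto
        have "\<lfloor>f c / t N\<rfloor> = \<lfloor>g c / t N\<rfloor>"
          using fun_cong[OF eq, of c] c(1) by (simp add: \<Phi>_def)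
        then have "\<bar>f c / t N - g c / t N\<bar> < 1"
          by linarith
        then have "\<bar>f c - g c\<bar> < t N"
          using t[of N] by (simp add: diff_divide_distrib[symmetric] abs_divide)
        moreover have "\<bar>f c - f x\<bar> \<le> t N" "\<bar>g c - g x\<bar> \<le> t N"
          using f g c k(2) x unfolding T_def by blast+
        ultimately show ?thesis
          by linarith
      qed
      have intI: "integrable lborel (\<lambda>x. ?I x * (h x)\<^sup>2)" if "h \<in> U" for h
        by (rule Bochner_Integration.integrable_bound[OF Lspace_2D(3)[OF L2[OF that]]])
           (use Lspace_2D(1)[OF L2[OF that]] in \<open>auto simp: indicator_def\<close>)
      have "integrable lborel (indicator (cball 0 (real N)) :: 'a \<Rightarrow> real)"
        using emeasure_lborel_cball_finite[of "0::'a" "real N"] by (intro integrable_real_indicator) auto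
      then have intB: "integrable lborel (\<lambda>x::'a. indicator (cball 0 (real N)) x * (9 * (t N)\<^sup>2))"
        by (rule integrable_mult_left)
      have "e\<^sup>2 \<le> (l2norm (\<lambda>x. f x - g x))\<^sup>2"
        using sep[OF fU gU ne] e by (intro power_mono) auto
      also have "\<dots> = (\<integral>x. (f x - g x)\<^sup>2 \<partial>lborel)"
        by (rule l2norm_eq_integral(1)[OF Lspace_2_linear(2)[OF L2[OF fU] L2[OF gU]]])
      also have "\<dots> \<le> (\<integral>x. indicator (cball 0 (real N)) x * (9 * (t N)\<^sup>2)
          + 2 * (?I x * (f x)\<^sup>2) + 2 * (?I x * (g x)\<^sup>2) \<partial>lborel)"
      proof (rule integral_mono)
        show "integrable lborel (\<lambda>x. (f x - g x)\<^sup>2)"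
          by (rule Lspace_2D(3)[OF Lspace_2_linear(2)[OF L2[OF fU] L2[OF gU]]])
        show "integrable lborel (\<lambda>x. indicator (cball 0 (real N)) x * (9 * (t N)\<^sup>2)
          + 2 * (?I x * (f x)\<^sup>2) + 2 * (?I x * (g x)\<^sup>2))"
          by (intro Bochner_Integration.integrable_add integrable_mult_right intI intB fU gU)
        fix x :: 'a
        show "(f x - g x)\<^sup>2 \<le> indicator (cball 0 (real N)) x * (9 * (t N)\<^sup>2)
          + 2 * (?I x * (f x)\<^sup>2) + 2 * (?I x * (g x)\<^sup>2)"
        proof (cases "x \<in> cball 0 (real N)")
          case True
          have "\<bar>f x - g x\<bar>\<^sup>2 \<le> (3 * t N)\<^sup>2"
            using close[OF True] by (intro power_mono) auto
          then show ?thesis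
            using True by (simp add: power_mult_distrib)
        next
          case False
          have "(f x - g x)\<^sup>2 \<le> 2 * (f x)\<^sup>2 + 2 * (g x)\<^sup>2"
            using zero_le_power2[of "f x + g x"] by (simp add: power2_sum power2_diff)
          then show ?thesis
            using False by simp
        qed
      qed
      also have "\<dots> = v N * (9 * (t N)\<^sup>2) + 2 * (\<integral>x. ?I x * (f x)\<^sup>2 \<partial>lborel) + 2 * (\<integral>x. ?I x * (g x)\<^sup>2 \<partial>lborel)"
        using intI[OF fU] intI[OF gU] intB by (simp add: v_def)
      also have "\<dots> < v N * (9 * (t N)\<^sup>2) + 2 * (e\<^sup>2 / 16) + 2 * (e\<^sup>2 / 16)"
        using f g unfolding T_def by auto
      also have "v N * (9 * (t N)\<^sup>2) \<le> e\<^sup>2 / 4"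
      proof -
        have "v N \<le> (v N + 1)\<^sup>2"
          using v0[of N] by (simp add: power2_sum)
        then have "v N * (9 * (t N)\<^sup>2) \<le> (v N + 1)\<^sup>2 * (9 * (t N)\<^sup>2)"
          by (rule mult_right_mono) simp
        also have "\<dots> = e\<^sup>2 / 4"
        proof -
          have "w\<^sup>2 * (9 * (e / (6 * w))\<^sup>2) = e\<^sup>2 / 4" if "0 < w" for w
            using that by (simp add: power_divide power_mult_distrib)
          from this[OF v1] show ?thesis
            unfolding t_def .
        qed
        finally show ?thesis .
      qed
      finally have "e\<^sup>2 < e\<^sup>2 / 4 + 2 * (e\<^sup>2 / 16) + 2 * (e\<^sup>2 / 16)"
        by linarith
      moreover have "0 < e\<^sup>2"
        using e by simp
      ultimately show False
        by linarith
    qed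
    moreover have "countable (\<Phi> ` T N j)"
      by (rule countable_subset[of _ "Pi\<^sub>E k (\<lambda>_. UNIV)"])
         (auto simp: \<Phi>_def intro: countable_PiE[OF k(1)])
    ultimately show ?thesis
      by (rule countable_image_inj_on[rotated])
  qed
  ultimately show ?thesis
    by (meson countable_UN countable_subset countableI_type)
qed

section \<open>Variance of the empirical process\<close>

text \<open>
  The cross terms of the squared sum of centred variables vanish because the integral of a product
  of functions of single coordinates factorises.
\<close>

lemma iid_mean_square_deviation:
  fixes h :: "'b \<Rightarrow> real"
  assumes P: "prob_space P" and h: "h \<in> borel_measurable P" and bd: "\<And>x. \<bar>h x\<bar> \<le> B" and n: "n \<ge> (1::nat)"
  shows "(\<integral>\<^sup>+X. ennreal (((\<Sum>i<n. h (X i)) / real n - (\<integral>x. h x \<partial>P))\<^sup>2) \<partial>PiM {..<n} (\<lambda>_. P))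
    \<le> (\<integral>\<^sup>+x. ennreal ((h x)\<^sup>2) \<partial>P) / ennreal (real n)"
proof -
  interpret P: prob_space P by (rule P)
  interpret product_sigma_finite "\<lambda>_::nat. P" ..
  note [measurable] = h
  define \<mu> where "\<mu> = (\<integral>x. h x \<partial>P)"
  define g where "g x = h x - \<mu>" for x
  have [measurable]: "g \<in> borel_measurable P"
    unfolding g_def[abs_def] by measurable
  have inth: "integrable P h"
    by (rule P.integrable_const_bound[of _ B]) (use bd in auto)
  have inth2: "integrable P (\<lambda>x. (h x)\<^sup>2)"
  proof (rule P.integrable_const_bound[of _ "B\<^sup>2"])
    show "AE x in P. norm ((h x)\<^sup>2) \<le> B\<^sup>2"
      using bd by (intro AE_I2) (simp, metis abs_ge_zero power2_abs power_mono)
  qed measurable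
  have intg: "integrable P g"
    unfolding g_def[abs_def] using inth by simp
  have intg2: "integrable P (\<lambda>x. g x * g x)"
    unfolding g_def using inth inth2 by (simp add: algebra_simps power2_eq_square)
  have g0: "(\<integral>x. g x \<partial>P) = 0"
    unfolding g_def using inth by (simp add: \<mu>_def P.prob_space)
  have g2: "(\<integral>x. g x * g x \<partial>P) \<le> (\<integral>x. (h x)\<^sup>2 \<partial>P)"
  proof -
    have "(\<integral>x. g x * g x \<partial>P) = (\<integral>x. (h x)\<^sup>2 - 2 * \<mu> * h x + \<mu>\<^sup>2 \<partial>P)"
      unfolding g_def by (intro Bochner_Integration.integral_cong refl) (simp add: power2_eq_square algebra_simps)
    also have "\<dots> = (\<integral>x. (h x)\<^sup>2 \<partial>P) - \<mu>\<^sup>2"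
      using inth inth2 by (simp add: \<mu>_def[symmetric] P.prob_space power2_eq_square)
    finally show ?thesis
      by simp
  qed
  let ?M = "PiM {..<n} (\<lambda>_. P)"
  \<comment> \<open>The product of these factors over k is \<open>g (X i) * g (X j)\<close>, also when i and j coincide.\<close>
  define F where "F i j k x = (if k = i then g x else 1) * (if k = j then g x else 1)" for i j k :: nat and x
  have intF: "integrable P (F i j k)" for i j k
    unfolding F_def[abs_def] using intg intg2 by (cases "k = i"; cases "k = j") auto
  have prodF: "(\<Prod>k<n. F i j k (X k)) = g (X i) * g (X j)" if "i < n" "j < n" for i j X
    unfolding F_def using that by (simp add: prod.distrib prod.delta)
  have cross: "integrable ?M (\<lambda>X. g (X i) * g (X j))"
      "(\<integral>X. g (X i) * g (X j) \<partial>?M) = (if i = j then (\<integral>x. g x * g x \<partial>P) else 0)"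
    if ij: "i < n" "j < n" for i j
  proof -
    show "integrable ?M (\<lambda>X. g (X i) * g (X j))"
      using product_integrable_prod[of "{..<n}" "F i j"] intF prodF[OF ij] by simp
    have "(\<integral>X. g (X i) * g (X j) \<partial>?M) = (\<Prod>k<n. \<integral>x. F i j k x \<partial>P)"
      using product_integral_prod[of "{..<n}" "F i j"] intF prodF[OF ij] by simp
    also have "\<dots> = (if i = j then (\<integral>x. g x * g x \<partial>P) else 0)"
    proof (cases "i = j")
      case True
      then have "(\<integral>x. F i j k x \<partial>P) = (if k = i then (\<integral>x. g x * g x \<partial>P) else 1)" for k
        by (simp add: F_def P.prob_space)
      then show ?thesis
        using True ij by (simp add: prod.delta)
    next
      case False
      then have "(\<integral>x. F i j i x \<partial>P) = 0"
        using g0 by (simp add: F_def)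
      then show ?thesis
        using False ij by (auto intro!: prod_zero)
    qed
    finally show "(\<integral>X. g (X i) * g (X j) \<partial>?M) = (if i = j then (\<integral>x. g x * g x \<partial>P) else 0)" .
  qed
  have expand: "((\<Sum>i<n. h (X i)) / real n - \<mu>)\<^sup>2 = (\<Sum>i<n. \<Sum>j<n. g (X i) * g (X j)) / (real n)\<^sup>2" for X
  proof -
    have "(\<Sum>i<n. h (X i)) / real n - \<mu> = (\<Sum>i<n. g (X i)) / real n"
      using n by (simp add: g_def sum_subtractf diff_divide_distrib)
    then show ?thesis
      by (simp add: power_divide power2_eq_square[of "sum _ _"] sum_product)
  qed
  have "(\<integral>\<^sup>+X. ennreal (((\<Sum>i<n. h (X i)) / real n - \<mu>)\<^sup>2) \<partial>?M)
     = ennreal (\<integral>X. ((\<Sum>i<n. h (X i)) / real n - \<mu>)\<^sup>2 \<partial>?M)"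
    unfolding expand
    by (intro nn_integral_eq_integral integrable_divide Bochner_Integration.integrable_sum cross(1) AE_I2)
       (auto simp: expand[symmetric])
  also have "(\<integral>X. ((\<Sum>i<n. h (X i)) / real n - \<mu>)\<^sup>2 \<partial>?M)
     = (\<Sum>i<n. \<Sum>j<n. (\<integral>X. g (X i) * g (X j) \<partial>?M)) / (real n)\<^sup>2"
  proof -
    have "(\<integral>X. (\<Sum>j<n. g (X i) * g (X j)) \<partial>?M) = (\<Sum>j<n. (\<integral>X. g (X i) * g (X j) \<partial>?M))" if "i < n" for i
      using that by (intro Bochner_Integration.integral_sum cross(1)) auto
    moreover have "(\<integral>X. (\<Sum>i<n. \<Sum>j<n. g (X i) * g (X j)) \<partial>?M) = (\<Sum>i<n. (\<integral>X. (\<Sum>j<n. g (X i) * g (X j)) \<partial>?M))"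
      by (intro Bochner_Integration.integral_sum Bochner_Integration.integrable_sum cross(1)) auto
    ultimately show ?thesis
      unfolding expand by simp
  qed
  also have "\<dots> = (\<integral>x. g x * g x \<partial>P) / real n"
    using n by (simp add: cross(2) power2_eq_square)
  also have "\<dots> \<le> (\<integral>x. (h x)\<^sup>2 \<partial>P) / real n"
    using g2 by (rule divide_right_mono) simp
  also have "ennreal \<dots> = (\<integral>\<^sup>+x. ennreal ((h x)\<^sup>2) \<partial>P) / ennreal (real n)"
    using inth2 n by (simp add: nn_integral_eq_integral divide_ennreal)
  finally show ?thesis
    unfolding \<mu>_def by (simp add: ennreal_leI)
qed

lemma prob_space_density:
  assumes "prob_density p"
  shows "prob_space (density lborel (\<lambda>x. ennreal (p x)))"
  using assms by (intro prob_spaceI) (simp add: prob_density_def emeasure_density)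

lemma prob_density_integrable:
  assumes "prob_density p"
  shows "integrable lborel p"
  using assms by (simp add: prob_density_def integrable_iff_bounded)

text \<open>
  The kernel density estimator at y, centred at its mean under the density p. It represents the
  empirical process of the smoothed functions by transposition.
\<close>

definition kernel_deviation ::
    "('a::euclidean_space \<Rightarrow> real) \<Rightarrow> ('a \<Rightarrow> real) \<Rightarrow> nat \<Rightarrow> (nat \<Rightarrow> 'a) \<Rightarrow> 'a \<Rightarrow> real" where
  "kernel_deviation \<kappa> p n X y = (\<Sum>i<n. \<kappa> (y - X i)) / real n - (\<integral>x. p x * \<kappa> (y - x) \<partial>lborel)"

context bounded_kernel
begin

text \<open>
  Transposing the smoothing operator reflects the kernel, so the results on smoothing also apply to
  the mean of the kernel density estimator.
\<close>

lemma reflected_kernel: "bounded_kernel (\<lambda>z. \<kappa> (- z)) A B"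
proof
  show "continuous_on UNIV (\<lambda>z. \<kappa> (- z))"
    by (intro continuous_on_compose2[OF kernel_continuous] continuous_intros) auto
  show "integrable lborel (\<lambda>z. \<kappa> (- z))"
    using integrable_lborel_affine[OF kernel_integrable, of "-1" 0] by simp
  show "(\<integral>z. \<bar>\<kappa> (- z)\<bar> \<partial>lborel) \<le> A"
    using integral_lborel_affine[of "\<lambda>z. \<bar>\<kappa> z\<bar>" "-1" 0] kernel_L1 by simp
qed (rule kernel_bound)

lemma kernel_deviation_Lspace_2:
  assumes p: "integrable lborel p" and n: "n \<ge> 1"
  shows "kernel_deviation \<kappa> p n X \<in> Lspace 2"
proof -
  interpret reflected: bounded_kernel "\<lambda>z. \<kappa> (- z)" A B
    by (rule reflected_kernel)
  have zero: "(\<lambda>y. 0) \<in> Lspace 2"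
    by (simp add: Lspace_2_iff)
  have "(\<lambda>y. \<Sum>i<k. \<kappa> (y - X i)) \<in> Lspace 2" for k
    by (induction k) (auto intro: zero Lspace_2_linear(1) kernel_shift_Lspace_2)
  then have "(\<lambda>y. (\<Sum>i<n. \<kappa> (y - X i)) / real n) \<in> Lspace 2"
    using zero by (intro Lspace_2_linear(4))
  from Lspace_2_linear(2)[OF this reflected.kernel_smooth_Lspace_2[OF p]]
  show ?thesis
    by (simp add: kernel_smooth_def kernel_deviation_def[abs_def])
qed

lemma empirical_process_eq_kernel_deviation:
  assumes f: "integrable lborel f" and p: "integrable lborel p"
  shows "(\<Sum>i<n. kernel_smooth \<kappa> f (X i)) / real n - (\<integral>x. kernel_smooth \<kappa> f x * p x \<partial>lborel)
    = (\<integral>y. f y * kernel_deviation \<kappa> p n X y \<partial>lborel)"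
proof -
  interpret reflected: bounded_kernel "\<lambda>z. \<kappa> (- z)" A B
    by (rule reflected_kernel)
  have [measurable]: "f \<in> borel_measurable borel" "p \<in> borel_measurable borel"
    using f p by auto
  have B: "0 \<le> B"
    by (rule kernel_constants_nonneg)
  define q where "q y = (\<integral>x. p x * \<kappa> (y - x) \<partial>lborel)" for y
  have q: "q = kernel_smooth (\<lambda>z. \<kappa> (- z)) p"
    by (simp add: q_def kernel_smooth_def fun_eq_iff)
  have [measurable]: "q \<in> borel_measurable borel"
    unfolding q by (rule reflected.kernel_smooth_measurable[OF p])
  have qbd: "\<bar>q y\<bar> \<le> (\<integral>x. B * \<bar>p x\<bar> \<partial>lborel)" for y
  proof -
    have "\<bar>q y\<bar> \<le> (\<integral>x. \<bar>p x * \<kappa> (y - x)\<bar> \<partial>lborel)"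
      unfolding q_def by (rule integral_abs_bound)
    also have "\<dots> \<le> (\<integral>x. B * \<bar>p x\<bar> \<partial>lborel)"
      using p kernel_bound reflected.integrable_mult_kernel[OF p, of y]
      by (intro integral_mono integrable_abs) (auto simp: abs_mult mult.commute[of B] mult_left_mono)
    finally show ?thesis .
  qed
  have intq: "integrable lborel (\<lambda>y. f y * q y)"
  proof (rule Bochner_Integration.integrable_bound)
    show "integrable lborel (\<lambda>y. f y * (\<integral>x. B * \<bar>p x\<bar> \<partial>lborel))"
      using f by (rule integrable_mult_left)
    show "AE y in lborel. norm (f y * q y) \<le> norm (f y * (\<integral>x. B * \<bar>p x\<bar> \<partial>lborel))"
      unfolding norm_mult
      by (intro AE_I2 mult_left_mono) (auto intro: order_trans[OF qbd])
  qed measurable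
  have pair: "integrable (lborel \<Otimes>\<^sub>M lborel) (\<lambda>(x, y). f y * \<kappa> (y - x) * p x)"
  proof (rule integrableI_bounded)
    have "(\<integral>\<^sup>+z. ennreal (norm (case z of (x, y) \<Rightarrow> f y * \<kappa> (y - x) * p x)) \<partial>(lborel \<Otimes>\<^sub>M lborel))
       = (\<integral>\<^sup>+x. (\<integral>\<^sup>+y. ennreal (norm (f y * \<kappa> (y - x) * p x)) \<partial>lborel) \<partial>lborel)"
      by (subst lborel.nn_integral_fst[symmetric]) auto
    also have "\<dots> \<le> (\<integral>\<^sup>+x. (\<integral>\<^sup>+y. ennreal (norm (f y)) * (ennreal B * ennreal (norm (p x))) \<partial>lborel) \<partial>lborel)"
    proof (intro nn_integral_mono)
      fix x y
      have "norm (f y * \<kappa> (y - x) * p x) \<le> norm (f y) * (B * norm (p x))"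
        using kernel_bound[of "y - x"] by (simp add: abs_mult mult.assoc mult_left_mono mult_right_mono)
      then show "ennreal (norm (f y * \<kappa> (y - x) * p x)) \<le> ennreal (norm (f y)) * (ennreal B * ennreal (norm (p x)))"
        using B by (simp add: ennreal_mult[symmetric] ennreal_leI)
    qed
    also have "\<dots> < \<infinity>"
      using f p by (simp add: nn_integral_multc nn_integral_cmult nn_integral_eq_integral ennreal_mult_less_top)
    finally show "(\<integral>\<^sup>+z. ennreal (norm (case z of (x, y) \<Rightarrow> f y * \<kappa> (y - x) * p x)) \<partial>(lborel \<Otimes>\<^sub>M lborel)) < \<infinity>" .
  qed measurable
  have "(\<integral>x. kernel_smooth \<kappa> f x * p x \<partial>lborel) = (\<integral>x. (\<integral>y. f y * \<kappa> (y - x) * p x \<partial>lborel) \<partial>lborel)"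
    unfolding kernel_smooth_def by simp
  also have "\<dots> = (\<integral>y. (\<integral>x. f y * \<kappa> (y - x) * p x \<partial>lborel) \<partial>lborel)"
    using lborel_pair.Fubini_integral[OF pair] by simp
  also have "\<dots> = (\<integral>y. f y * q y \<partial>lborel)"
    unfolding q_def by (intro Bochner_Integration.integral_cong refl)
      (simp add: mult.assoc mult.commute[of "\<kappa> _"])
  finally have mean: "(\<integral>x. kernel_smooth \<kappa> f x * p x \<partial>lborel) = (\<integral>y. f y * q y \<partial>lborel)" .
  have "(\<integral>y. f y * kernel_deviation \<kappa> p n X y \<partial>lborel)
     = (\<integral>y. (\<Sum>i<n. f y * \<kappa> (y - X i)) / real n - f y * q y \<partial>lborel)"
    by (intro Bochner_Integration.integral_cong refl)
       (simp add: kernel_deviation_def q_def right_diff_distrib sum_distrib_left)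
  also have "\<dots> = (\<Sum>i<n. kernel_smooth \<kappa> f (X i)) / real n - (\<integral>y. f y * q y \<partial>lborel)"
    using intq integrable_mult_kernel[OF f]
    by (simp add: Bochner_Integration.integral_sum kernel_smooth_def)
  finally show ?thesis
    unfolding mean by simp
qed

lemma measurable_kernel_deviation:
  assumes p: "prob_density p"
  shows "(\<lambda>(X, y). ennreal ((kernel_deviation \<kappa> p n X y)\<^sup>2)) \<in> borel_measurable (iid_law n p \<Otimes>\<^sub>M lborel)"
proof -
  interpret reflected: bounded_kernel "\<lambda>z. \<kappa> (- z)" A B
    by (rule reflected_kernel)
  have [measurable]: "(\<lambda>y. \<integral>x. p x * \<kappa> (y - x) \<partial>lborel) \<in> borel_measurable borel"
    using reflected.kernel_smooth_measurable[OF prob_density_integrable[OF p]]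
    by (simp add: kernel_smooth_def[abs_def])
  have [measurable]: "(\<lambda>X. X i) \<in> measurable (iid_law n p) borel" if "i < n" for i
  proof -
    have "(\<lambda>X. X i) \<in> measurable (iid_law n p) (density lborel (\<lambda>x. ennreal (p x)))"
      unfolding iid_law_def using that by (intro measurable_component_singleton) auto
    then show ?thesis
      by simp
  qed
  show ?thesis
    unfolding kernel_deviation_def by measurable
qed

lemma measurable_kernel_deviation_norm:
  assumes p: "prob_density p"
  shows "(\<lambda>X. \<integral>\<^sup>+y. ennreal ((kernel_deviation \<kappa> p n X y)\<^sup>2) \<partial>lborel) \<in> borel_measurable (iid_law n p)"
  using lborel.borel_measurable_nn_integral_fst[OF measurable_kernel_deviation[OF p]] by simp

text \<open>
  For each y the mean square is at most \<open>1 / n\<close> times the second moment of \<open>\<kappa> (y - x)\<close>.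
  Integrating over y first replaces that moment by \<open>\<bar>\<kappa>\<bar>\<^sub>2\<^sup>2\<close>, whatever the density.
\<close>

lemma expected_kernel_deviation:
  assumes p: "prob_density p" and n: "n \<ge> 1"
  shows "(\<integral>\<^sup>+X. (\<integral>\<^sup>+y. ennreal ((kernel_deviation \<kappa> p n X y)\<^sup>2) \<partial>lborel) \<partial>iid_law n p)
    \<le> ennreal (A * B / real n)"
proof -
  let ?P = "density lborel (\<lambda>x. ennreal (p x))"
  interpret P: prob_space ?P
    by (rule prob_space_density[OF p])
  interpret product_sigma_finite "\<lambda>_::nat. ?P" ..
  interpret sample: finite_product_sigma_finite "\<lambda>_::nat. ?P" "{..<n}"
    by standard simp
  interpret pair: pair_sigma_finite "iid_law n p" "lborel :: 'a measure"
    unfolding iid_law_def by (intro pair_sigma_finite.intro sample.sigma_finite_measure_axioms lborel.sigma_finite_measure_axioms)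
  have [measurable]: "p \<in> borel_measurable borel" and p0: "\<And>x. 0 \<le> p x"
    and p1: "(\<integral>\<^sup>+x. ennreal (p x) \<partial>lborel) = 1"
    using p by (auto simp: prob_density_def)
  have pint: "integrable lborel p"
    using p by (rule prob_density_integrable)
  have mean: "(\<integral>x. p x * \<kappa> (y - x) \<partial>lborel) = (\<integral>x. \<kappa> (y - x) \<partial>?P)" for y
    using p0 by (subst integral_density) auto
  have "(\<integral>\<^sup>+X. (\<integral>\<^sup>+y. ennreal ((kernel_deviation \<kappa> p n X y)\<^sup>2) \<partial>lborel) \<partial>iid_law n p)
     = (\<integral>\<^sup>+y. (\<integral>\<^sup>+X. ennreal ((kernel_deviation \<kappa> p n X y)\<^sup>2) \<partial>iid_law n p) \<partial>lborel)"
    by (rule pair.Fubini'[symmetric]) (rule measurable_kernel_deviation[OF p])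
  also have "\<dots> \<le> (\<integral>\<^sup>+y. (\<integral>\<^sup>+x. ennreal (p x) * ennreal ((\<kappa> (y - x))\<^sup>2) \<partial>lborel) / ennreal (real n) \<partial>lborel)"
  proof (rule nn_integral_mono)
    fix y
    have "(\<integral>\<^sup>+X. ennreal ((kernel_deviation \<kappa> p n X y)\<^sup>2) \<partial>iid_law n p)
       \<le> (\<integral>\<^sup>+x. ennreal ((\<kappa> (y - x))\<^sup>2) \<partial>?P) / ennreal (real n)"
      unfolding kernel_deviation_def mean iid_law_def
      using kernel_bound by (intro iid_mean_square_deviation P.prob_space_axioms n) auto
    then show "(\<integral>\<^sup>+X. ennreal ((kernel_deviation \<kappa> p n X y)\<^sup>2) \<partial>iid_law n p)
       \<le> (\<integral>\<^sup>+x. ennreal (p x) * ennreal ((\<kappa> (y - x))\<^sup>2) \<partial>lborel) / ennreal (real n)"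
      by (simp add: nn_integral_density)
  qed
  also have "\<dots> = (\<integral>\<^sup>+y. (\<integral>\<^sup>+x. ennreal (p x) * ennreal ((\<kappa> (y - x))\<^sup>2) \<partial>lborel) \<partial>lborel) / ennreal (real n)"
    by (rule nn_integral_divide) measurable
  also have "(\<integral>\<^sup>+y. (\<integral>\<^sup>+x. ennreal (p x) * ennreal ((\<kappa> (y - x))\<^sup>2) \<partial>lborel) \<partial>lborel)
     = (\<integral>\<^sup>+x. (\<integral>\<^sup>+y. ennreal (p x) * ennreal ((\<kappa> (y - x))\<^sup>2) \<partial>lborel) \<partial>lborel)"
    by (rule lborel_pair.Fubini') measurable
  also have "\<dots> \<le> (\<integral>\<^sup>+x. ennreal (p x) * ennreal (A * B) \<partial>lborel)"
    by (intro nn_integral_mono) (simp add: nn_integral_cmult kernel_L2_shift mult_left_mono)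
  also have "\<dots> = ennreal (A * B)"
    using p1 by (simp add: nn_integral_multc)
  finally show ?thesis
    using n kernel_constants_nonneg by (simp add: divide_ennreal divide_right_mono_ennreal)
qed

end

section \<open>The estimator on a smoothed separated set\<close>

text \<open>
  The factor 3 in the separation is what keeps images apart: smoothing moves two elements of S
  towards each other by at most \<open>2 b\<close>, so at least a third of their distance survives.
\<close>

locale smoothed_net = bounded_kernel \<kappa> A B
  for \<kappa> :: "'a::euclidean_space \<Rightarrow> real" and A B +
  fixes S :: "('a \<Rightarrow> real) set" and b :: real
  assumes net_nonempty: "S \<noteq> {}"
    and kernel_constants_pos: "0 < A * B"
    and net_integrable: "\<And>f. f \<in> S \<Longrightarrow> integrable lborel f"
    and net_L2: "\<And>f. f \<in> S \<Longrightarrow> f \<in> Lspace 2"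
    and b_pos: "0 < b"
    and net_error: "\<And>f. f \<in> S \<Longrightarrow> l2norm (\<lambda>x. f x - kernel_smooth \<kappa> f x) \<le> b"
    and net_separated: "\<And>f g. f \<in> S \<Longrightarrow> g \<in> S \<Longrightarrow> f \<noteq> g \<Longrightarrow> 3 * b \<le> l2norm (\<lambda>x. f x - g x)"
begin

definition model :: "('a \<Rightarrow> real) set" where
  "model = kernel_smooth \<kappa> ` S"

definition radius :: real where
  "radius = 3 * sqrt (A * B)"

lemma radius_pos: "0 < radius"
  using kernel_constants_pos by (simp add: radius_def)

lemma smooth_L2: "f \<in> S \<Longrightarrow> kernel_smooth \<kappa> f \<in> Lspace 2"
  by (rule kernel_smooth_Lspace_2[OF net_integrable])

lemma l2norm_diff_le_smooth:
  assumes f: "f \<in> S" and g: "g \<in> S"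
  shows "l2norm (\<lambda>x. f x - g x) \<le> 3 * l2norm (\<lambda>x. kernel_smooth \<kappa> f x - kernel_smooth \<kappa> g x)"
proof (cases "f = g")
  case True
  then have "l2norm (\<lambda>x. f x - g x) = 0"
    using l2norm_eq_integral(1)[OF Lspace_2_linear(2)[OF net_L2[OF f] net_L2[OF g]]] by simp
  then show ?thesis
    by simp
next
  case False
  have "l2norm (\<lambda>x. f x - g x) \<le> l2norm (\<lambda>x. f x - kernel_smooth \<kappa> f x) + l2norm (\<lambda>x. kernel_smooth \<kappa> f x - g x)"
    by (rule l2norm_triangle_diff[OF net_L2[OF f] net_L2[OF g] smooth_L2[OF f]])
  also have "l2norm (\<lambda>x. kernel_smooth \<kappa> f x - g x)
     \<le> l2norm (\<lambda>x. kernel_smooth \<kappa> f x - kernel_smooth \<kappa> g x) + l2norm (\<lambda>x. kernel_smooth \<kappa> g x - g x)"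
    by (rule l2norm_triangle_diff[OF smooth_L2[OF f] net_L2[OF g] smooth_L2[OF g]])
  also have "l2norm (\<lambda>x. kernel_smooth \<kappa> g x - g x) = l2norm (\<lambda>x. g x - kernel_smooth \<kappa> g x)"
    by (rule l2norm_minus_commute)
  finally show ?thesis
    using net_error[OF f] net_error[OF g] net_separated[OF f g False] by linarith
qed

lemma countable_model: "countable model"
proof (rule countable_separated_continuous_L2[where e=b])
  show "continuous_on UNIV u" if "u \<in> model" for u
    using that continuous_kernel_smooth[OF net_integrable] by (auto simp: model_def)
  show "u \<in> Lspace 2" if "u \<in> model" for u
    using that smooth_L2 by (auto simp: model_def)
  fix u v assume "u \<in> model" "v \<in> model" "u \<noteq> v"
  then obtain f g where fg: "f \<in> S" "g \<in> S" "f \<noteq> g" "u = kernel_smooth \<kappa> f" "v = kernel_smooth \<kappa> g"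
    by (auto simp: model_def)
  then show "b \<le> l2norm (\<lambda>x. u x - v x)"
    using net_separated[OF fg(1-3)] l2norm_diff_le_smooth[OF fg(1,2)] by simp
qed (rule b_pos)

text \<open>
  The supremum of \<open>K f - K g\<close> is bounded by the norm of \<open>f - g\<close>, which separation bounds in turn by
  three times the norm of \<open>K f - K g\<close>.
\<close>

lemma l2_model_smoothed: "l2_model model radius"
  unfolding l2_model_def
proof (intro conjI ballI)
  show "countable model"
    by (rule countable_model)
  show "model \<noteq> {}"
    using net_nonempty by (simp add: model_def)
  show "model \<subseteq> Lspace 1 \<inter> Lspace 2"
    using smooth_L2 integrable_kernel_smooth[OF net_integrable] by (auto simp: model_def Lspace_1_iff)
  show "0 < radius"
    by (rule radius_pos)
  fix u v assume "u \<in> model" "v \<in> model"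
  then obtain f g where fg: "f \<in> S" "g \<in> S" and uv: "u = kernel_smooth \<kappa> f" "v = kernel_smooth \<kappa> g"
    by (auto simp: model_def)
  have L2: "(\<lambda>x. f x - g x) \<in> Lspace 2" "(\<lambda>x. u x - v x) \<in> Lspace 2"
    using fg by (auto simp: uv intro: Lspace_2_linear(2) net_L2 smooth_L2)
  have "\<bar>u x - v x\<bar> \<le> radius * l2norm (\<lambda>x. u x - v x)" for x
  proof -
    have "\<bar>u x - v x\<bar> \<le> sqrt (A * B) * l2norm (\<lambda>x. f x - g x)"
      unfolding uv kernel_smooth_diff[OF net_integrable[OF fg(1)] net_integrable[OF fg(2)], symmetric]
      by (rule abs_kernel_smooth_le[OF L2(1)])
    also have "\<dots> \<le> sqrt (A * B) * (3 * l2norm (\<lambda>x. u x - v x))"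
      unfolding uv using l2norm_diff_le_smooth[OF fg] kernel_constants_pos by (intro mult_left_mono) auto
    finally show ?thesis
      by (simp add: radius_def mult_ac)
  qed
  then show "sup_norm (\<lambda>x. u x - v x) \<le> ennreal radius * Lnorm 2 (\<lambda>x. u x - v x)"
    unfolding sup_norm_def l2norm_eq_integral(2)[OF L2(2)]
    using radius_pos by (intro SUP_least) (simp add: ennreal_mult[symmetric] ennreal_leI)
qed

text \<open>
  Every test direction is the smoothing of a function h of norm at most 3, so transposition and
  Cauchy-Schwarz give one bound for all pairs at once.
\<close>

lemma empirical_process_bound:
  assumes p: "prob_density p" and n: "n \<ge> 1" and uv: "u \<in> model" "v \<in> model"
  shows "\<bar>(\<Sum>i<n. l2_direction u v (X i)) / real n - (\<integral>y. l2_direction u v y * p y \<partial>lborel)\<bar>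
    \<le> 3 * l2norm (kernel_deviation \<kappa> p n X)"
proof (cases "u = v")
  case True
  then show ?thesis
    by (simp add: l2_direction_def)
next
  case False
  obtain f g where fg: "f \<in> S" "g \<in> S" and eq: "u = kernel_smooth \<kappa> f" "v = kernel_smooth \<kappa> g"
    using uv by (auto simp: model_def)
  define N where "N = l2norm (\<lambda>x. u x - v x)"
  have N: "0 < N"
    unfolding N_def by (rule l2_model_norm_pos[OF l2_model_smoothed uv False])
  define h where "h x = (f x - g x) / N" for x
  have pint: "integrable lborel p"
    using p by (rule prob_density_integrable)
  have diff: "(\<lambda>x. f x - g x) \<in> Lspace 2"
    using fg by (intro Lspace_2_linear(2) net_L2)
  have h: "integrable lborel h" "h \<in> Lspace 2"
    unfolding h_def[abs_def]
    using net_integrable fg by (auto intro: Lspace_2_linear(4)[OF diff diff])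
  have "l2norm h = l2norm (\<lambda>x. f x - g x) / N"
    unfolding h_def[abs_def] using N by (simp add: l2norm_scale[OF diff])
  also have "\<dots> \<le> 3"
    using l2norm_diff_le_smooth[OF fg] N by (simp add: N_def[unfolded eq] eq pos_divide_le_eq)
  finally have h3: "l2norm h \<le> 3" .
  have "l2_direction u v x = kernel_smooth \<kappa> h x" for x
  proof -
    have "kernel_smooth \<kappa> h x = kernel_smooth \<kappa> (\<lambda>x. f x - g x) x / N"
      by (simp add: kernel_smooth_def h_def)
    then show ?thesis
      using False net_integrable fg
      by (simp add: l2_direction_def l2norm_def[symmetric] N_def eq kernel_smooth_diff)
  qed
  then have "(\<Sum>i<n. l2_direction u v (X i)) / real n - (\<integral>y. l2_direction u v y * p y \<partial>lborel)
     = (\<integral>y. h y * kernel_deviation \<kappa> p n X y \<partial>lborel)"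
    by (simp add: empirical_process_eq_kernel_deviation[OF h(1) pint])
  also have "\<bar>\<dots>\<bar> \<le> l2norm h * l2norm (kernel_deviation \<kappa> p n X)"
    by (rule l2_Cauchy_Schwarz[OF h(2) kernel_deviation_Lspace_2[OF pint n]])
  also have "\<dots> \<le> 3 * l2norm (kernel_deviation \<kappa> p n X)"
    using h3 by (intro mult_right_mono) auto
  finally show ?thesis .
qed

text \<open>
  The oracle inequality is squared with \<open>(x + y + v)\<^sup>2 \<le> 3 (x\<^sup>2 + y\<^sup>2 + v\<^sup>2)\<close>, which yields the
  constants \<open>27 = 3 * 3\<^sup>2\<close> and \<open>432 = 3 * 12\<^sup>2\<close>.
\<close>

lemma l2_estimator_risk:
  assumes est: "l2_estimator model radius \<epsilon> n phat" and eps: "0 < \<epsilon>" and n: "n \<ge> 1"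
    and p: "prob_density p" "p \<in> Lspace 2" and f: "f \<in> S"
  shows "(\<integral>\<^sup>+X. (Lnorm 2 (\<lambda>x. p x - phat X x))\<^sup>2 \<partial>iid_law n p)
    \<le> ennreal (27 * (l2norm (\<lambda>x. p x - kernel_smooth \<kappa> f x))\<^sup>2 + 432 * (A * B / real n) + 432 * \<epsilon>\<^sup>2 * (A * B / real n))"
proof -
  define a where "a = l2norm (\<lambda>x. p x - kernel_smooth \<kappa> f x)"
  define w where "w X = l2norm (kernel_deviation \<kappa> p n X)" for X
  have pint: "integrable lborel p"
    using p(1) by (rule prob_density_integrable)
  have fM: "kernel_smooth \<kappa> f \<in> model"
    using f by (simp add: model_def)
  let ?c = "27 * a\<^sup>2 + 432 * \<epsilon>\<^sup>2 * (A * B / real n)"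
  have space: "space (iid_law n p) = space (PiM {..<n} (\<lambda>_. borel :: 'a measure))"
    by (simp add: iid_law_def space_PiM)
  have pointwise: "(Lnorm 2 (\<lambda>x. p x - phat X x))\<^sup>2
     \<le> ennreal ?c + ennreal 432 * (\<integral>\<^sup>+y. ennreal ((kernel_deviation \<kappa> p n X y)\<^sup>2) \<partial>lborel)"
    if X: "X \<in> space (iid_law n p)" for X
  proof -
    have X': "X \<in> space (PiM {..<n} (\<lambda>_. borel :: 'a measure))"
      using X space by simp
    have "phat X \<in> model"
      using est measurable_space[OF _ X', of phat "count_space model"] by (auto simp: l2_estimator_def)
    then have L2: "(\<lambda>x. p x - phat X x) \<in> Lspace 2"
      using p(2) smooth_L2 by (intro Lspace_2_linear(2)) (auto simp: model_def)
    define z where "z = sqrt (A * B) * \<epsilon> / real n"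
    have z0: "0 \<le> z"
      using kernel_constants_pos eps by (simp add: z_def)
    have "l2norm (\<lambda>x. p x - phat X x) \<le> 3 * a + 4 * (3 * w X) + 4 * radius * \<epsilon> / real n"
      unfolding a_def w_def
      by (rule l2_estimator_oracle_inequality[OF est n p(2) fM X' eps empirical_process_bound[OF p(1) n]])
    also have "\<dots> = 3 * a + 12 * w X + 12 * z"
      by (simp add: radius_def z_def)
    finally have "(l2norm (\<lambda>x. p x - phat X x))\<^sup>2 \<le> (3 * a + 12 * w X + 12 * z)\<^sup>2"
      by (rule power_mono) simp
    also have "\<dots> \<le> 3 * ((3 * a)\<^sup>2 + (12 * w X)\<^sup>2 + (12 * z)\<^sup>2)"
    proof -
      have "0 \<le> (x - y)\<^sup>2 + (y - v)\<^sup>2 + (x - v)\<^sup>2" for x y v :: real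
        by simp
      then have "(x + y + v)\<^sup>2 \<le> 3 * (x\<^sup>2 + y\<^sup>2 + v\<^sup>2)" for x y v :: real
        by (simp add: power2_eq_square algebra_simps)
      then show ?thesis .
    qed
    also have "\<dots> = 27 * a\<^sup>2 + 432 * (w X)\<^sup>2 + 432 * z\<^sup>2"
      by (simp add: power_mult_distrib)
    also have "z\<^sup>2 \<le> \<epsilon>\<^sup>2 * (A * B / real n)"
    proof -
      have "z\<^sup>2 = \<epsilon>\<^sup>2 * (A * B / (real n)\<^sup>2)"
        using kernel_constants_pos by (simp add: z_def power_divide power_mult_distrib)
      also have "\<dots> \<le> \<epsilon>\<^sup>2 * (A * B / real n)"
        using kernel_constants_pos n
        by (intro mult_left_mono divide_left_mono) (auto simp: power2_eq_square)
      finally show ?thesis .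
    qed
    finally have "(l2norm (\<lambda>x. p x - phat X x))\<^sup>2 \<le> ?c + 432 * (w X)\<^sup>2"
      by simp
    moreover have "0 \<le> ?c"
      using kernel_constants_pos by simp
    moreover have "ennreal (?c + 432 * (w X)\<^sup>2) = ennreal ?c + ennreal 432 * ennreal ((w X)\<^sup>2)" if "0 \<le> ?c"
      using that by (subst ennreal_plus) (auto simp: ennreal_mult)
    ultimately have "ennreal ((l2norm (\<lambda>x. p x - phat X x))\<^sup>2) \<le> ennreal ?c + ennreal 432 * ennreal ((w X)\<^sup>2)"
      by (metis ennreal_leI)
    moreover have "ennreal ((w X)\<^sup>2) = (\<integral>\<^sup>+y. ennreal ((kernel_deviation \<kappa> p n X y)\<^sup>2) \<partial>lborel)"
      unfolding w_def Lnorm_2_square[symmetric]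
        l2norm_eq_integral(2)[OF kernel_deviation_Lspace_2[OF pint n]]
      by (simp add: ennreal_power)
    ultimately show ?thesis
      by (simp add: l2norm_eq_integral(2)[OF L2] ennreal_power)
  qed
  have "(\<integral>\<^sup>+X. (Lnorm 2 (\<lambda>x. p x - phat X x))\<^sup>2 \<partial>iid_law n p)
     \<le> (\<integral>\<^sup>+X. ennreal ?c + ennreal 432 * (\<integral>\<^sup>+y. ennreal ((kernel_deviation \<kappa> p n X y)\<^sup>2) \<partial>lborel) \<partial>iid_law n p)"
    by (rule nn_integral_mono) (rule pointwise)
  also have "\<dots> = ennreal ?c + ennreal 432 * (\<integral>\<^sup>+X. (\<integral>\<^sup>+y. ennreal ((kernel_deviation \<kappa> p n X y)\<^sup>2) \<partial>lborel) \<partial>iid_law n p)"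
  proof -
    have "emeasure (iid_law n p) (space (iid_law n p)) = 1"
      unfolding iid_law_def
      by (rule prob_space.emeasure_space_1[OF prob_space_PiM[OF prob_space_density[OF p(1)]]])
    moreover have "(\<lambda>X. \<integral>\<^sup>+y. ennreal ((kernel_deviation \<kappa> p n X y)\<^sup>2) \<partial>lborel) \<in> borel_measurable (iid_law n p)"
      by (rule measurable_kernel_deviation_norm[OF p(1)])
    ultimately show ?thesis
      by (simp add: nn_integral_add nn_integral_cmult)
  qed
  also have "\<dots> \<le> ennreal ?c + ennreal 432 * ennreal (A * B / real n)"
    by (intro add_left_mono mult_left_mono expected_kernel_deviation p(1) n) simp
  also have "\<dots> = ennreal (?c + 432 * (A * B / real n))"
  proof -
    have "ennreal (432 * (A * B / real n)) = ennreal 432 * ennreal (A * B / real n)"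
      by (rule ennreal_mult') simp
    moreover have "ennreal (?c + 432 * (A * B / real n)) = ennreal ?c + ennreal (432 * (A * B / real n))"
      using kernel_constants_pos by (intro ennreal_plus) auto
    ultimately show ?thesis
      by simp
  qed
  finally show ?thesis
    by (simp add: a_def algebra_simps)
qed

end

section \<open>Besov classes\<close>

text \<open>
  Densities are replaced by functions with \<open>L\<^sub>1\<close> norm at most one, so that the zero function belongs
  to the class and the net is non-empty even if no density meets the Besov constraint.
\<close>

definition besov_ball :: "real \<Rightarrow> real \<Rightarrow> real \<Rightarrow> ('a::euclidean_space \<Rightarrow> real) set" where
  "besov_ball \<alpha> s r = {f. integrable lborel f \<and> f \<in> Lspace 2 \<and>
     (\<integral>\<^sup>+x. ennreal \<bar>f x\<bar> \<partial>lborel) \<le> 1 \<and> besov_seminorm \<alpha> s f \<le> ennreal r}"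

lemma zero_in_besov_ball: "(\<lambda>x. 0) \<in> besov_ball \<alpha> s r"
proof -
  have "besov_seminorm \<alpha> s (\<lambda>x::'a. 0) \<le> 0"
    unfolding besov_seminorm_def
    by (rule SUP_least) (simp add: Lnorm_def ennreal_powr_def finite_difference_expand[abs_def])
  then show ?thesis
    by (simp add: besov_ball_def Lspace_2_iff)
qed

lemma besov_densities_subset: "besov_densities \<alpha> s r \<subseteq> besov_ball \<alpha> s r"
  by (auto simp: besov_densities_def besov_ball_def prob_density_integrable)
     (simp add: prob_density_def)

lemma separated_net_exists:
  fixes F :: "('a::euclidean_space \<Rightarrow> real) set"
  assumes F: "F \<noteq> {}" and L2: "\<And>f. f \<in> F \<Longrightarrow> f \<in> Lspace 2" and e: "0 \<le> e"
  obtains S where "S \<subseteq> F" "S \<noteq> {}"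
    "\<And>f g. f \<in> S \<Longrightarrow> g \<in> S \<Longrightarrow> f \<noteq> g \<Longrightarrow> e \<le> l2norm (\<lambda>x. f x - g x)"
    "\<And>f. f \<in> F \<Longrightarrow> \<exists>g\<in>S. l2norm (\<lambda>x. f x - g x) \<le> e"
proof -
  obtain S where S: "S \<subseteq> F" "pairwise (\<lambda>f g. e \<le> l2norm (\<lambda>x. f x - g x)) S"
    and max: "\<And>f. f \<in> F \<Longrightarrow> f \<in> S \<or> (\<exists>g\<in>S. \<not> (e \<le> l2norm (\<lambda>x. f x - g x) \<and> e \<le> l2norm (\<lambda>x. g x - f x)))"
    using maximal_pairwise_subset[of F "\<lambda>f g. e \<le> l2norm (\<lambda>x. f x - g x)"] by blast
  have dense: "\<exists>g\<in>S. l2norm (\<lambda>x. f x - g x) \<le> e" if f: "f \<in> F" for f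
    using max[OF f]
  proof
    assume "f \<in> S"
    moreover have "l2norm (\<lambda>x. f x - f x) = 0"
      using l2norm_eq_integral(1)[OF Lspace_2_linear(2)[OF L2[OF f] L2[OF f]]] by simp
    ultimately show ?thesis
      using e by (intro bexI[of _ f]) auto
  next
    assume "\<exists>g\<in>S. \<not> (e \<le> l2norm (\<lambda>x. f x - g x) \<and> e \<le> l2norm (\<lambda>x. g x - f x))"
    then show ?thesis
      by (auto simp: l2norm_minus_commute[of _ f] not_le intro: less_imp_le)
  qed
  then have "S \<noteq> {}"
    using F by blast
  then show thesis
    using S dense by (intro that[of S]) (auto simp: pairwise_def)
qed

text \<open>
  The exponent of \<open>\<delta>\<close> makes the variance \<open>1 / (N \<delta>\<^sup>d)\<close> equal to \<open>\<rho>\<close>, and the value of \<open>\<rho>\<close> is the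
  solution of the remaining equation between the two parts of the squared bias; both are linear
  equations in logarithms.
\<close>

lemma optimal_bandwidth:
  fixes s \<alpha> r d N :: real
  assumes s: "2 \<le> s" and \<alpha>: "0 < \<alpha>" and r: "0 < r" and d: "0 < d" and N: "0 < N"
  defines "E \<equiv> d * (s - 1) + s * \<alpha>"
  defines "\<rho> \<equiv> r powr (d * s / E) / N powr (\<alpha> * s / E)"
  defines "\<delta> \<equiv> (N * \<rho>) powr (- 1 / d)"
  shows "0 < \<rho>" "0 < \<delta>" "\<delta> powr d = 1 / (N * \<rho>)" "\<rho> powr (2 - s) * (r * \<delta> powr \<alpha>) powr s = \<rho>"
proof -
  have E: "0 < E"
    using assms by (simp add: E_def add_nonneg_pos)
  show \<rho>: "0 < \<rho>"
    using r N by (simp add: \<rho>_def)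
  show \<delta>: "0 < \<delta>"
    using N \<rho> by (simp add: \<delta>_def)
  have "\<delta> powr d = (N * \<rho>) powr (- 1)"
    using d by (simp add: \<delta>_def powr_powr)
  then show "\<delta> powr d = 1 / (N * \<rho>)"
    using N \<rho> by (simp add: powr_minus_divide)
  have ln\<rho>: "E * ln \<rho> = d * s * ln r - \<alpha> * s * ln N"
    using r N E unfolding \<rho>_def by (simp add: ln_div ln_powr right_diff_distrib)
  have ln\<delta>: "d * ln \<delta> = - (ln N + ln \<rho>)"
    using N \<rho> d by (simp add: \<delta>_def ln_powr ln_mult)
  have "ln (\<rho> powr (2 - s) * (r * \<delta> powr \<alpha>) powr s) = (2 - s) * ln \<rho> + s * (ln r + \<alpha> * ln \<delta>)"
    using r \<rho> \<delta> by (simp add: ln_mult ln_powr)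
  also have "\<dots> = ln \<rho>"
  proof -
    have "d * ((2 - s) * ln \<rho> + s * (ln r + \<alpha> * ln \<delta>)) = d * (2 - s) * ln \<rho> + d * s * ln r + s * \<alpha> * (d * ln \<delta>)"
      by (simp add: algebra_simps)
    also have "\<dots> = d * ln \<rho> - (E * ln \<rho>) + d * s * ln r - \<alpha> * s * ln N"
      unfolding ln\<delta> E_def by (simp add: algebra_simps)
    also have "\<dots> = d * ln \<rho>"
      unfolding ln\<rho> by simp
    finally show ?thesis
      using d by simp
  qed
  finally show "\<rho> powr (2 - s) * (r * \<delta> powr \<alpha>) powr s = \<rho>"
    using r \<rho> \<delta> by (simp add: ln_inj_iff)
qed

text \<open>
  A density p of the class is within \<open>3 b\<close> of the net and smoothing adds b, so the model comes within
  \<open>\<bar>t - p\<bar>\<^sub>2 + 4 b\<close> of the target t, and \<open>(x + 4 b)\<^sup>2 \<le> 2 x\<^sup>2 + 32 b\<^sup>2\<close>. If t - p is not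
  square integrable then the bound is infinite.
\<close>

lemma besov_estimator_risk:
  fixes s \<alpha> \<epsilon> r :: real
  assumes s: "2 \<le> s" and \<alpha>: "0 < \<alpha>" and \<epsilon>: "0 < \<epsilon>" and r: "0 < r" and n: "n \<ge> 1"
  defines "d \<equiv> real DIM('a::euclidean_space)"
  defines "\<rho> \<equiv> r powr (d * s / (d * (s - 1) + s * \<alpha>)) / real n powr (\<alpha> * s / (d * (s - 1) + s * \<alpha>))"
  defines "m \<equiv> nat \<lfloor>\<alpha>\<rfloor> + 1"
  defines "G \<equiv> 4 ^ m / tent_mass TYPE('a)"
  shows "\<exists>(M :: ('a \<Rightarrow> real) set) R phat. l2_estimator M R \<epsilon> n phat \<and>
    (\<forall>t p. prob_density t \<longrightarrow> p \<in> besov_densities \<alpha> s r \<longrightarrow>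
      (\<integral>\<^sup>+X. (Lnorm 2 (\<lambda>x. t x - phat X x))\<^sup>2 \<partial>iid_law n t)
      \<le> ennreal (54 + 864 * (2 ^ m + 1) + 432 * G * (1 + \<epsilon>\<^sup>2)) * ((Lnorm 2 (\<lambda>x. t x - p x))\<^sup>2 + ennreal \<rho>))"
proof -
  have d: "0 < d"
    by (simp add: d_def)
  have G: "0 < G"
    using tent_mass_pos[where 'a='a] by (simp add: G_def)
  define \<delta> where "\<delta> = (real n * \<rho>) powr (- 1 / d)"
  have \<rho>: "0 < \<rho>" and \<delta>: "0 < \<delta>" and \<delta>d: "\<delta> powr d = 1 / (real n * \<rho>)"
    and balance: "\<rho> powr (2 - s) * (r * \<delta> powr \<alpha>) powr s = \<rho>"
    using optimal_bandwidth[OF s \<alpha> r d, of "real n"] n unfolding \<rho>_def \<delta>_def by auto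
  define b where "b = sqrt ((2 ^ m + 1) * \<rho>)"
  have b: "0 < b"
    using \<rho> by (simp add: b_def add_pos_pos)
  define \<kappa> where "\<kappa> = (difference_kernel m \<delta> :: 'a \<Rightarrow> real)"
  define A :: real where "A = 2 ^ m"
  define B where "B = 2 ^ m / tent_mass TYPE('a) / \<delta> ^ DIM('a)"
  interpret bounded_kernel \<kappa> A B
    unfolding \<kappa>_def A_def B_def by (rule bounded_kernel_difference_kernel[OF \<delta>])
  have AB: "A * B = G * real n * \<rho>"
  proof -
    have "\<delta> ^ DIM('a) = 1 / (real n * \<rho>)"
      using \<delta> \<delta>d by (simp add: d_def powr_realpow)
    then show ?thesis
      by (simp add: A_def B_def G_def power_mult_distrib[symmetric])
  qed
  have ABn: "A * B / real n = G * \<rho>"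
    using n by (simp add: AB)
  let ?F = "besov_ball \<alpha> s r :: ('a \<Rightarrow> real) set"
  have F_L2: "\<And>f. f \<in> ?F \<Longrightarrow> f \<in> Lspace 2" and F_int: "\<And>f. f \<in> ?F \<Longrightarrow> integrable lborel f"
    by (auto simp: besov_ball_def)
  have error: "l2norm (\<lambda>x. f x - kernel_smooth \<kappa> f x) \<le> b" if f: "f \<in> ?F" for f
  proof -
    have L2: "(\<lambda>x. f x - kernel_smooth \<kappa> f x) \<in> Lspace 2"
      by (rule Lspace_2_linear(2)[OF F_L2[OF f] kernel_smooth_Lspace_2[OF F_int[OF f]]])
    have "(\<integral>\<^sup>+x. ennreal ((f x - kernel_smooth \<kappa> f x)\<^sup>2) \<partial>lborel)
       \<le> ennreal (2 ^ m * \<rho> + \<rho> powr (2 - s) * (r * \<delta> powr \<alpha>) powr s)"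
      using f s \<alpha> r \<delta> \<rho> unfolding \<kappa>_def m_def besov_ball_def by (intro smoothing_error) auto
    then have "ennreal ((l2norm (\<lambda>x. f x - kernel_smooth \<kappa> f x))\<^sup>2) \<le> ennreal ((2 ^ m + 1) * \<rho>)"
      unfolding Lnorm_2_square[symmetric] l2norm_eq_integral(2)[OF L2] balance
      by (simp add: ennreal_power algebra_simps)
    then show ?thesis
      unfolding b_def using \<rho> by (intro real_le_rsqrt) simp
  qed
  obtain S where S: "S \<subseteq> ?F" "S \<noteq> {}"
    "\<And>f g. f \<in> S \<Longrightarrow> g \<in> S \<Longrightarrow> f \<noteq> g \<Longrightarrow> 3 * b \<le> l2norm (\<lambda>x. f x - g x)"
    and dense: "\<And>f. f \<in> ?F \<Longrightarrow> \<exists>g\<in>S. l2norm (\<lambda>x. f x - g x) \<le> 3 * b"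
  proof (rule separated_net_exists[of ?F "3 * b"])
    show "?F \<noteq> {}"
      using zero_in_besov_ball by blast
    show "0 \<le> 3 * b"
      using b by simp
  qed (use F_L2 in auto)
  interpret smoothed_net \<kappa> A B S b
  proof
    show "0 < A * B"
      unfolding AB using G n \<rho> by simp
  qed (use S F_int F_L2 error b in auto)
  obtain phat where est: "l2_estimator model radius \<epsilon> n phat"
    using l2_estimator_exists[OF l2_model_smoothed \<epsilon>] by blast
  let ?C = "54 + 864 * (2 ^ m + 1) + 432 * G * (1 + \<epsilon>\<^sup>2)"
  have C: "0 < ?C"
    using G by (simp add: add_pos_nonneg)
  have "(\<integral>\<^sup>+X. (Lnorm 2 (\<lambda>x. t x - phat X x))\<^sup>2 \<partial>iid_law n t)
      \<le> ennreal ?C * ((Lnorm 2 (\<lambda>x. t x - p x))\<^sup>2 + ennreal \<rho>)"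
    if t: "prob_density t" and p: "p \<in> besov_densities \<alpha> s r" for t p
  proof (cases "(\<lambda>x. t x - p x) \<in> Lspace 2")
    case False
    have "t \<in> borel_measurable borel" "p \<in> borel_measurable borel"
      using t p by (auto simp: prob_density_def besov_densities_def)
    then have "Lnorm 2 (\<lambda>x. t x - p x) = top"
      using False by (simp add: Lspace_def top.not_eq_extremum[symmetric])
    then show ?thesis
      using C by (simp add: power2_eq_square ennreal_mult_top)
  next
    case True
    have pF: "p \<in> ?F"
      using p besov_densities_subset by blast
    have pL2: "p \<in> Lspace 2"
      by (rule F_L2[OF pF])
    have tL2: "t \<in> Lspace 2"
      using Lspace_2_linear(1)[OF True pL2] by simp
    obtain f where f: "f \<in> S" "l2norm (\<lambda>x. p x - f x) \<le> 3 * b"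
      using dense[OF pF] by blast
    define a where "a = l2norm (\<lambda>x. t x - p x)"
    have "l2norm (\<lambda>x. t x - kernel_smooth \<kappa> f x) \<le> a + l2norm (\<lambda>x. p x - kernel_smooth \<kappa> f x)"
      unfolding a_def by (rule l2norm_triangle_diff[OF tL2 smooth_L2[OF f(1)] pL2])
    moreover have "l2norm (\<lambda>x. p x - kernel_smooth \<kappa> f x)
       \<le> l2norm (\<lambda>x. p x - f x) + l2norm (\<lambda>x. f x - kernel_smooth \<kappa> f x)"
      by (rule l2norm_triangle_diff[OF pL2 smooth_L2[OF f(1)] net_L2[OF f(1)]])
    ultimately have "l2norm (\<lambda>x. t x - kernel_smooth \<kappa> f x) \<le> a + 4 * b"
      using f(2) net_error[OF f(1)] by linarith
    then have "(l2norm (\<lambda>x. t x - kernel_smooth \<kappa> f x))\<^sup>2 \<le> (a + 4 * b)\<^sup>2"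
      by (rule power_mono) simp
    also have "\<dots> \<le> 2 * a\<^sup>2 + 32 * b\<^sup>2"
      using zero_le_power2[of "a - 4 * b"] by (simp add: power2_sum power2_diff power_mult_distrib)
    also have "b\<^sup>2 = (2 ^ m + 1) * \<rho>"
      using \<rho> by (simp add: b_def)
    finally have a: "(l2norm (\<lambda>x. t x - kernel_smooth \<kappa> f x))\<^sup>2 \<le> 2 * a\<^sup>2 + 32 * ((2 ^ m + 1) * \<rho>)" .
    have "(\<integral>\<^sup>+X. (Lnorm 2 (\<lambda>x. t x - phat X x))\<^sup>2 \<partial>iid_law n t)
       \<le> ennreal (27 * (l2norm (\<lambda>x. t x - kernel_smooth \<kappa> f x))\<^sup>2 + 432 * (A * B / real n)
          + 432 * \<epsilon>\<^sup>2 * (A * B / real n))"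
      by (rule l2_estimator_risk[OF est \<epsilon> n t tL2 f(1)])
    also have "\<dots> \<le> ennreal (?C * (a\<^sup>2 + \<rho>))"
    proof (rule ennreal_leI)
      have "27 * (l2norm (\<lambda>x. t x - kernel_smooth \<kappa> f x))\<^sup>2 + 432 * (A * B / real n) + 432 * \<epsilon>\<^sup>2 * (A * B / real n)
         \<le> 54 * a\<^sup>2 + (864 * (2 ^ m + 1) + 432 * G * (1 + \<epsilon>\<^sup>2)) * \<rho>"
        using a unfolding ABn by (simp add: algebra_simps)
      also have "\<dots> \<le> ?C * a\<^sup>2 + ?C * \<rho>"
        using G \<rho> by (intro add_mono mult_right_mono) (auto intro!: add_nonneg_nonneg)
      finally show "27 * (l2norm (\<lambda>x. t x - kernel_smooth \<kappa> f x))\<^sup>2 + 432 * (A * B / real n)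
          + 432 * \<epsilon>\<^sup>2 * (A * B / real n) \<le> ?C * (a\<^sup>2 + \<rho>)"
        by (simp only: distrib_left)
    qed
    also have "\<dots> = ennreal ?C * ((Lnorm 2 (\<lambda>x. t x - p x))\<^sup>2 + ennreal \<rho>)"
      using C \<rho> unfolding l2norm_eq_integral(2)[OF True] a_def[symmetric]
      by (simp add: ennreal_power ennreal_mult a_def)
    finally show ?thesis .
  qed
  then show ?thesis
    using est by blast
qed

lemma le_mult_INF_add_ennreal:
  fixes f :: "'b \<Rightarrow> ennreal"
  assumes C: "0 < C" and le: "\<And>p. p \<in> F \<Longrightarrow> L \<le> ennreal C * (f p + ennreal c)"
  shows "L \<le> ennreal C * ((INF p\<in>F. f p) + ennreal c)"
proof -
  have "L / ennreal C - ennreal c \<le> (INF p\<in>F. f p)"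
  proof (rule INF_greatest)
    fix p assume "p \<in> F"
    then have "L / ennreal C \<le> f p + ennreal c"
      using le[of p] C by (intro divide_le_posI_ennreal) (auto simp: mult.commute)
    then show "L / ennreal C - ennreal c \<le> f p"
      by (simp add: ennreal_minus_le_iff add.commute)
  qed
  then have "L / ennreal C \<le> (INF p\<in>F. f p) + ennreal c"
    by (simp add: ennreal_minus_le_iff add.commute)
  then have "ennreal C * (L / ennreal C) \<le> ennreal C * ((INF p\<in>F. f p) + ennreal c)"
    by (rule mult_left_mono) simp
  moreover have "ennreal C * (L / ennreal C) = L"
    using C by (simp add: ennreal_times_divide ennreal_mult_divide_eq mult.commute[of _ L])
  ultimately show ?thesis
    by simp
qed

theorem corollary5:
  fixes s \<alpha> \<epsilon> :: real
  assumes "2 \<le> s" and "0 < \<alpha>" and "0 < \<epsilon>"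
  shows "\<exists>C>0. \<forall>r>0. \<forall>n\<ge>1.
    \<exists>(M :: (real ^ 'd \<Rightarrow> real) set) R phat.
      l2_estimator M R \<epsilon> n phat \<and>
      (\<forall>pstar :: real ^ 'd \<Rightarrow> real. prob_density pstar \<longrightarrow>
        (\<integral>\<^sup>+X. (Lnorm 2 (\<lambda>x. pstar x - phat X x))\<^sup>2 \<partial>iid_law n pstar)
        \<le> ennreal C *
            ((INF p\<in>besov_densities \<alpha> s r. (Lnorm 2 (\<lambda>x. pstar x - p x))\<^sup>2)
             + ennreal (r powr (real CARD('d) * s / (real CARD('d) * (s - 1) + s * \<alpha>))
                         / real n powr (\<alpha> * s / (real CARD('d) * (s - 1) + s * \<alpha>))
                        + 1 / real n)))"
proof -
  define m where "m = nat \<lfloor>\<alpha>\<rfloor> + 1"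
  define G where "G = 4 ^ m / tent_mass TYPE(real ^ 'd)"
  define C where "C = 54 + 864 * (2 ^ m + 1) + 432 * G * (1 + \<epsilon>\<^sup>2)"
  have "0 < G"
    using tent_mass_pos[where 'a="real ^ 'd"] by (simp add: G_def)
  then have C: "0 < C"
    by (simp add: C_def add_pos_nonneg)
  show ?thesis
  proof (rule exI[of _ C], intro conjI C allI impI)
    fix r :: real and n :: nat assume r: "0 < r" and n: "1 \<le> n"
    let ?\<rho> = "r powr (real CARD('d) * s / (real CARD('d) * (s - 1) + s * \<alpha>))
       / real n powr (\<alpha> * s / (real CARD('d) * (s - 1) + s * \<alpha>))"
    have dim: "DIM(real ^ 'd) = CARD('d)"
      by simp
    obtain M :: "(real ^ 'd \<Rightarrow> real) set" and R phat where est: "l2_estimator M R \<epsilon> n phat"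
      and risk: "\<And>t p. prob_density t \<Longrightarrow> p \<in> besov_densities \<alpha> s r \<Longrightarrow>
        (\<integral>\<^sup>+X. (Lnorm 2 (\<lambda>x. t x - phat X x))\<^sup>2 \<partial>iid_law n t)
        \<le> ennreal C * ((Lnorm 2 (\<lambda>x. t x - p x))\<^sup>2 + ennreal ?\<rho>)"
      using besov_estimator_risk[OF assms r n, where 'a="real ^ 'd", folded m_def, folded G_def, folded C_def]
      unfolding dim by blast
    have "(\<integral>\<^sup>+X. (Lnorm 2 (\<lambda>x. t x - phat X x))\<^sup>2 \<partial>iid_law n t)
       \<le> ennreal C * ((INF p\<in>besov_densities \<alpha> s r. (Lnorm 2 (\<lambda>x. t x - p x))\<^sup>2) + ennreal (?\<rho> + 1 / real n))"
      if t: "prob_density t" for t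
    proof (rule le_mult_INF_add_ennreal[OF C])
      fix p :: "real ^ 'd \<Rightarrow> real" assume "p \<in> besov_densities \<alpha> s r"
      then have "(\<integral>\<^sup>+X. (Lnorm 2 (\<lambda>x. t x - phat X x))\<^sup>2 \<partial>iid_law n t)
         \<le> ennreal C * ((Lnorm 2 (\<lambda>x. t x - p x))\<^sup>2 + ennreal ?\<rho>)"
        by (rule risk[OF t])
      also have "\<dots> \<le> ennreal C * ((Lnorm 2 (\<lambda>x. t x - p x))\<^sup>2 + ennreal (?\<rho> + 1 / real n))"
        by (intro mult_left_mono add_left_mono ennreal_leI) auto
      finally show "(\<integral>\<^sup>+X. (Lnorm 2 (\<lambda>x. t x - phat X x))\<^sup>2 \<partial>iid_law n t)
         \<le> ennreal C * ((Lnorm 2 (\<lambda>x. t x - p x))\<^sup>2 + ennreal (?\<rho> + 1 / real n))" .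
    qed
    then show "\<exists>(M :: (real ^ 'd \<Rightarrow> real) set) R phat.
      l2_estimator M R \<epsilon> n phat \<and>
      (\<forall>pstar :: real ^ 'd \<Rightarrow> real. prob_density pstar \<longrightarrow>
        (\<integral>\<^sup>+X. (Lnorm 2 (\<lambda>x. pstar x - phat X x))\<^sup>2 \<partial>iid_law n pstar)
        \<le> ennreal C *
            ((INF p\<in>besov_densities \<alpha> s r. (Lnorm 2 (\<lambda>x. pstar x - p x))\<^sup>2)
             + ennreal (?\<rho> + 1 / real n)))"
      using est by blast
  qed
qed

end
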